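(* Let $\mathcal E=\{(a,\rho_0),(b,\rho_1)\}$ be a binary qubit ensemble with $a,b>0$, $a+b=1$, and $\rho_0\ne\rho_1$, with Bloch vectors $r_0,r_1$. On the projective circle of unoriented measurement axes $n$ in the Bloch plane of the states, the mutual information $I(n)$ has exactly two stationary measurements: (1) the unique axis satisfying $(r_0-r_1)\cdot n=0$, at which $I=0$ and which is the global minimum; (2) the unique spectral PVM of $R_*$, at which $I=I_{\mathrm{acc}}(\mathcal E)$ and which is the global maximum. If $\rho_0=\rho_1$, then $I$ vanishes identically and every measurement is stationary.
   Context: Qubit states are written $\rho_x=\frac12(\mathbf 1+r_x\cdot\boldsymbol\sigma)$, $r_x\in\mathbb R^3$, $|r_x|\le1$, $\boldsymbol\sigma$ the Pauli vector; states may be pure. A rank-one PVM is given by an unoriented unit axis $n\in\mathbb S^2/\{\pm1\}$: $P_\pm(n)=\frac12(\mathbf 1\pm n\cdot\boldsymbol\sigma)$; swapping outcomes does not give a different measurement. Put $p(n)=\frac12(1+r_0\cdot n)$, $q(n)=\frac12(1+r_1\cdot n)$, $h(u)=-u\log u-(1-u)\log(1-u)$, and $I(n)=h(ap(n)+bq(n))-ah(p(n))-bh(q(n))$. The Bloch plane is $\mathrm{span}_{\mathbb R}\{r_0,r_1\}$; if this is not two-dimensional, fix any two-dimensional plane containing it. The projective circle is the set of unoriented unit axes in that plane; a measurement is stationary if the derivative of $I$ with respect to the angle on this circle vanishes there ($I$ is differentiable in the angle also at axes where some probability vanishes). For a finite POVM $M$, $I_{\mathcal E}(M)$ is the mutual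 information between the letter (prior $(a,b)$) and the outcome, and $I_{\mathrm{acc}}(\mathcal E)=\sup_MI_{\mathcal E}(M)$ over finite POVMs. The posterior functional on effects $0\le R\le\mathbf 1$ is $\Phi_{\mathcal E}(R)=a\,\mathrm{Tr}\,\rho_0\log\frac Ra+b\,\mathrm{Tr}\,\rho_1\log\frac{\mathbf 1-R}{b}$, where the logarithms are compressed to the supports of $R$ and $\mathbf 1-R$ if $\mathrm{supp}\rho_0\subseteq\mathrm{supp}R$ and $\mathrm{supp}\rho_1\subseteq\mathrm{supp}(\mathbf 1-R)$, and $\Phi_{\mathcal E}(R)=-\infty$ otherwise. For $\rho_0\neq\rho_1$, $R_*$ denotes the maximizer of $\Phi_{\mathcal E}$, which is unique and is not a multiple of $\mathbf 1$, so its two spectral projections form a rank-one PVM. *)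

theory Defs
  imports "HOL-Analysis.Analysis"
begin

type_synonym qmat = "complex^2^2"

definition cadjoint :: "qmat \<Rightarrow> qmat" where
  "cadjoint A = (\<chi> i j. cnj (A $ j $ i))"

definition hermitian :: "qmat \<Rightarrow> bool" where
  "hermitian A \<longleftrightarrow> cadjoint A = A"

text \<open>On \<^typ>\<open>complex^2\<close> the real inner product \<open>v \<bullet> w\<close> is the real part of the Hermitian one.\<close>

definition psd :: "qmat \<Rightarrow> bool" where
  "psd A \<longleftrightarrow> hermitian A \<and> (\<forall>v. 0 \<le> v \<bullet> (A *v v))"

definition effect :: "qmat \<Rightarrow> bool" where
  "effect R \<longleftrightarrow> psd R \<and> psd (mat 1 - R)"

text \<open>The support of a Hermitian matrix is the orthogonal complement of its kernel, i.e. its range.\<close>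

definition supp :: "qmat \<Rightarrow> (complex^2) set" where
  "supp A = range ((*v) A)"

text \<open>Spectral calculus for Hermitian matrices, whose eigenvalues are real.\<close>

definition eigenspace :: "qmat \<Rightarrow> real \<Rightarrow> (complex^2) set" where
  "eigenspace A l = {v. A *v v = l *\<^sub>R v}"

definition eigvals :: "qmat \<Rightarrow> real set" where
  "eigvals A = {l. \<exists>v. v \<noteq> 0 \<and> v \<in> eigenspace A l}"

definition orth_proj :: "(complex^2) set \<Rightarrow> qmat" where
  "orth_proj S = (THE P. hermitian P \<and> P ** P = P \<and> range ((*v) P) = S)"

definition eigenproj :: "qmat \<Rightarrow> real \<Rightarrow> qmat" where
  "eigenproj A l = orth_proj (eigenspace A l)"

definition spectral_projections :: "qmat \<Rightarrow> qmat set" where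
  "spectral_projections A = eigenproj A ` eigvals A"

text \<open>Logarithm of a positive semidefinite matrix compressed to its support: the kernel is left out.\<close>

definition supp_log :: "qmat \<Rightarrow> qmat" where
  "supp_log A = (\<Sum>l \<in> eigvals A - {0}. ln l *\<^sub>R eigenproj A l)"

definition pauli_x :: qmat where
  "pauli_x = vector [vector [0, 1], vector [1, 0]]"

definition pauli_y :: qmat where
  "pauli_y = vector [vector [0, - \<i>], vector [\<i>, 0]]"

definition pauli_z :: qmat where
  "pauli_z = vector [vector [1, 0], vector [0, - 1]]"

definition pauli :: "real^3 \<Rightarrow> qmat" where
  "pauli r = r $ 1 *\<^sub>R pauli_x + r $ 2 *\<^sub>R pauli_y + r $ 3 *\<^sub>R pauli_z"

definition bloch_state :: "real^3 \<Rightarrow> qmat" where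
  "bloch_state r = (1/2) *\<^sub>R (mat 1 + pauli r)"

text \<open>Unoriented axes are antipodal pairs. A rank-one PVM is the unordered pair of its projections,
  so that it depends on the unoriented axis only.\<close>

definition axis_of :: "real^3 \<Rightarrow> (real^3) set" where
  "axis_of n = {n, - n}"

definition pvm :: "real^3 \<Rightarrow> qmat set" where
  "pvm n = {(1/2) *\<^sub>R (mat 1 + pauli n), (1/2) *\<^sub>R (mat 1 - pauli n)}"

text \<open>The convention \<open>0 log 0 = 0\<close> holds throughout because \<open>ln 0 = 0\<close> in HOL.\<close>

definition bin_entropy :: "real \<Rightarrow> real" where
  "bin_entropy u = - u * ln u - (1 - u) * ln (1 - u)"

definition axis_prob :: "real^3 \<Rightarrow> real^3 \<Rightarrow> real" where
  "axis_prob r n = (1 + r \<bullet> n) / 2"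

definition axis_info :: "real \<Rightarrow> real \<Rightarrow> real^3 \<Rightarrow> real^3 \<Rightarrow> real^3 \<Rightarrow> real" where
  "axis_info a b r0 r1 n =
     bin_entropy (a * axis_prob r0 n + b * axis_prob r1 n)
       - a * bin_entropy (axis_prob r0 n) - b * bin_entropy (axis_prob r1 n)"

text \<open>Angular stationarity at \<open>n\<close> on the unit circle of the plane \<open>W\<close>, the angle being measured
  from \<open>n\<close>; the unit tangent \<open>t\<close> is determined up to sign.\<close>

definition stationary ::
  "real \<Rightarrow> real \<Rightarrow> real^3 \<Rightarrow> real^3 \<Rightarrow> (real^3) set \<Rightarrow> real^3 \<Rightarrow> bool" where
  "stationary a b r0 r1 W n \<longleftrightarrow>
     (\<exists>t \<in> W. norm t = 1 \<and> t \<bullet> n = 0 \<and>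
        ((\<lambda>\<theta>. axis_info a b r0 r1 (cos \<theta> *\<^sub>R n + sin \<theta> *\<^sub>R t)) has_real_derivative 0) (at 0))"

definition povm :: "qmat list \<Rightarrow> bool" where
  "povm M \<longleftrightarrow> (\<forall>E \<in> set M. psd E) \<and> sum_list M = mat 1"

definition born :: "qmat \<Rightarrow> qmat \<Rightarrow> real" where
  "born \<rho> E = Re (trace (\<rho> ** E))"

text \<open>Mutual information of a joint distribution \<open>J\<close> on finite alphabets \<open>X\<close> and \<open>K\<close>.\<close>

definition mutual_info :: "('x \<Rightarrow> 'k \<Rightarrow> real) \<Rightarrow> 'x set \<Rightarrow> 'k set \<Rightarrow> real" where
  "mutual_info J X K =
     (\<Sum>x\<in>X. \<Sum>k\<in>K. J x k * ln (J x k / ((\<Sum>l\<in>K. J x l) * (\<Sum>y\<in>X. J y k))))"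

definition joint_dist ::
  "real \<Rightarrow> real \<Rightarrow> qmat \<Rightarrow> qmat \<Rightarrow> qmat list \<Rightarrow> nat \<Rightarrow> nat \<Rightarrow> real" where
  "joint_dist a b \<rho>0 \<rho>1 M x k = (if x = 0 then a * born \<rho>0 (M ! k) else b * born \<rho>1 (M ! k))"

definition povm_info :: "real \<Rightarrow> real \<Rightarrow> qmat \<Rightarrow> qmat \<Rightarrow> qmat list \<Rightarrow> real" where
  "povm_info a b \<rho>0 \<rho>1 M = mutual_info (joint_dist a b \<rho>0 \<rho>1 M) {0, 1} {..<length M}"

definition acc_info :: "real \<Rightarrow> real \<Rightarrow> qmat \<Rightarrow> qmat \<Rightarrow> ereal" where
  "acc_info a b \<rho>0 \<rho>1 = (SUP M \<in> {M. povm M}. ereal (povm_info a b \<rho>0 \<rho>1 M))"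

definition posterior_fun :: "real \<Rightarrow> real \<Rightarrow> qmat \<Rightarrow> qmat \<Rightarrow> qmat \<Rightarrow> ereal" where
  "posterior_fun a b \<rho>0 \<rho>1 R =
     (if supp \<rho>0 \<subseteq> supp R \<and> supp \<rho>1 \<subseteq> supp (mat 1 - R)
      then ereal (a * Re (trace (\<rho>0 ** supp_log ((1/a) *\<^sub>R R)))
                + b * Re (trace (\<rho>1 ** supp_log ((1/b) *\<^sub>R (mat 1 - R)))))
      else - \<infinity>)"

definition R_star :: "real \<Rightarrow> real \<Rightarrow> qmat \<Rightarrow> qmat \<Rightarrow> qmat" where
  "R_star a b \<rho>0 \<rho>1 = arg_max (posterior_fun a b \<rho>0 \<rho>1) effect"

end

theory Submission
  imports Defs "HOL-Real_Asymp.Real_Asymp"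
begin

text \<open>For an axis \<open>n\<close> let \<open>x\<close> and \<open>y\<close> be the posterior probabilities of the first letter given the two
  outcomes. The operator with eigenvalues \<open>x, y\<close> along \<open>n\<close> maximizes the posterior functional among the
  effects diagonal along \<open>n\<close>, with value \<open>I(n)\<close>. If \<open>x \<noteq> y\<close> and \<open>n\<close> is stationary on the circle, then the
  off-diagonal part of the first-order condition holds as well, because both Bloch vectors lie in the
  plane. Since the logarithm is operator concave, the tangent inequality at this operator then yields a
  linear function that dominates the gain of each single POVM element, for every posterior assigned to
  it. So \<open>I(n)\<close> is at once the maximum of the posterior functional and the accessible information, and
  strictness of the tangent inequality makes the maximizer, hence \<open>n\<close>, unique. The case \<open>x = y\<close> is that of
  the axis orthogonal to \<open>r0 - r1\<close>.\<close>

section \<open>Spectral calculus in Bloch coordinates\<close>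

text \<open>The existence of a maximizer is not derived from compactness of the set of effects,
  which would call for semicontinuity of a functional with the value minus infinity. It comes from
  the circle: \<open>axis_info\<close> is continuous there and positive along
  \<open>r0 - r1\<close>, so its maximum is a stationary axis with \<open>x \<noteq> y\<close>, and
  the certificate at that axis turns the operator built from it into the maximizer over all effects.
  The off-diagonal condition is one real equation because each state has a single component
  transverse to \<open>n\<close> within the plane; this equation is the vanishing of the angular
  derivative. The component of an effect orthogonal to the plane is seen by neither state. What
  shapes the estimates is purity: a posterior may be 0 or 1, where the logarithm is infinite in
  mathematics and 0 in HOL. The inequalities are arranged so that such a logarithm always has the
  coefficient 0, and their equality cases are carried along because uniqueness rests on
  them.\<close>

lemma pauli_nth:
  "pauli r $ 1 $ 1 = of_real (r $ 3)" "pauli r $ 1 $ 2 = Complex (r $ 1) (- r $ 2)"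
  "pauli r $ 2 $ 1 = Complex (r $ 1) (r $ 2)" "pauli r $ 2 $ 2 = - of_real (r $ 3)"
  by (simp_all add: pauli_def pauli_x_def pauli_y_def pauli_z_def vector_2 complex_eq_iff)

lemma pauli_uminus: "pauli (- r) = - pauli r"
  by (simp add: pauli_def)

lemma pauli_scaleR: "pauli (c *\<^sub>R r) = c *\<^sub>R pauli r"
  by (simp add: pauli_def scaleR_right_distrib)

lemma bloch_state_nth:
  "bloch_state r $ 1 $ 1 = of_real ((1 + r $ 3) / 2)" "bloch_state r $ 1 $ 2 = Complex (r $ 1 / 2) (- r $ 2 / 2)"
  "bloch_state r $ 2 $ 1 = Complex (r $ 1 / 2) (r $ 2 / 2)" "bloch_state r $ 2 $ 2 = of_real ((1 - r $ 3) / 2)"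
  by (simp_all add: bloch_state_def pauli_nth mat_def complex_eq_iff)

lemma bloch_state_inject [simp]: "bloch_state r = bloch_state r' \<longleftrightarrow> r = r'"
  by (auto simp: vec_eq_iff forall_2 forall_3 bloch_state_nth complex_eq_iff)

lemma inner3: "(u::real^3) \<bullet> v = u $ 1 * v $ 1 + u $ 2 * v $ 2 + u $ 3 * v $ 3"
  by (simp add: inner_vec_def sum_3)

lemma born_bloch_state: "born (bloch_state r) (bloch_state m) = (1 + r \<bullet> m) / 2"
  by (simp add: born_def trace_def matrix_matrix_mult_def sum_2 bloch_state_nth inner3 field_simps)

lemma born_linear:
  "born \<rho> (A + B) = born \<rho> A + born \<rho> B" "born \<rho> (c *\<^sub>R A) = c * born \<rho> A"
  by (simp_all add: born_def trace_def matrix_matrix_mult_def sum_2 algebra_simps)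

lemma hermitian_bloch_state: "hermitian (bloch_state m)"
  by (auto simp: hermitian_def cadjoint_def vec_eq_iff forall_2 bloch_state_nth complex_eq_iff)

lemma bloch_state_idem:
  assumes "norm m = 1"
  shows "bloch_state m ** bloch_state m = bloch_state m"
proof -
  have "m \<bullet> m = 1" using assms by (simp add: dot_square_norm)
  then have "m $ 1 * m $ 1 + m $ 2 * m $ 2 + m $ 3 * m $ 3 = 1" by (simp add: inner3)
  then show ?thesis
    by (simp add: vec_eq_iff forall_2 bloch_state_nth complex_eq_iff matrix_matrix_mult_def sum_2)
       (simp add: field_simps)
qed

lemma bloch_state_uminus: "bloch_state m + bloch_state (- m) = mat 1"
  by (simp add: vec_eq_iff forall_2 bloch_state_nth complex_eq_iff mat_def field_simps)

lemma bloch_state_diff: "bloch_state m - bloch_state (- m) = pauli m"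
  by (simp add: vec_eq_iff forall_2 bloch_state_nth pauli_nth complex_eq_iff field_simps)

lemma bloch_state_orth:
  assumes "norm m = 1"
  shows "bloch_state m ** bloch_state (- m) = 0"
proof -
  have "bloch_state m ** bloch_state m + bloch_state m ** bloch_state (- m) = bloch_state m"
    by (metis bloch_state_uminus matrix_add_ldistrib matrix_mul_rid)
  then show ?thesis by (simp add: bloch_state_idem[OF assms])
qed

lemma hermitian_nth:
  assumes "hermitian A"
  shows "A $ 2 $ 1 = cnj (A $ 1 $ 2)" "Im (A $ 1 $ 1) = 0" "Im (A $ 2 $ 2) = 0"
proof -
  have *: "cnj (A $ j $ i) = A $ i $ j" for i j
    using arg_cong[OF assms[unfolded hermitian_def], of "\<lambda>B. B $ i $ j"] by (simp add: cadjoint_def)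
  show "A $ 2 $ 1 = cnj (A $ 1 $ 2)" by (simp add: *)
  show "Im (A $ 1 $ 1) = 0" "Im (A $ 2 $ 2) = 0"
    using *[of 1 1] *[of 2 2] by (simp_all add: complex_eq_iff)
qed

lemma hermitian_inner:
  assumes "hermitian A"
  shows "v \<bullet> (A *v w) = (A *v v) \<bullet> w"
  using hermitian_nth[OF assms]
  by (simp add: inner_vec_def matrix_vector_mult_def sum_2 inner_complex_def algebra_simps)

lemma psd_projection:
  assumes "hermitian P" "P ** P = P"
  shows "psd P"
proof -
  have "v \<bullet> (P *v v) = (P *v v) \<bullet> (P *v v)" for v
    by (metis assms hermitian_inner matrix_vector_mul_assoc)
  then show ?thesis using assms(1) by (simp add: psd_def)
qed

lemma hermitian_add: "hermitian A \<Longrightarrow> hermitian B \<Longrightarrow> hermitian (A + B)"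
  by (auto simp: hermitian_def cadjoint_def vec_eq_iff)

lemma hermitian_scaleR: "hermitian A \<Longrightarrow> hermitian (c *\<^sub>R A)"
  by (auto simp: hermitian_def cadjoint_def vec_eq_iff)

text \<open>For a unit vector \<open>m\<close> the two Bloch states are complementary rank-one
  projections, so \<open>s1\<close> and \<open>s2\<close> are the eigenvalues. They may coincide and
  are not ordered: every Hermitian matrix has this form, though not a unique one.\<close>

definition spec :: "real^3 \<Rightarrow> real \<Rightarrow> real \<Rightarrow> qmat" where
  "spec m s1 s2 = s1 *\<^sub>R bloch_state m + s2 *\<^sub>R bloch_state (- m)"

lemma scaleR_vector_mult: "A *v (c *\<^sub>R v) = c *\<^sub>R ((A::qmat) *v v)"
  by (simp add: matrix_vector_mult_def vec_eq_iff sum_2 scaleR_right_distrib)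

lemma scaleR_matrix_vector: "(c *\<^sub>R A) *v v = c *\<^sub>R ((A::qmat) *v v)"
  by (simp add: matrix_vector_mult_def vec_eq_iff sum_2 scaleR_right_distrib)

lemma psd_spec:
  assumes "norm m = 1" "0 \<le> s1" "0 \<le> s2"
  shows "psd (spec m s1 s2)"
proof -
  have "psd (bloch_state m)" "psd (bloch_state (- m))"
    using assms by (auto intro!: psd_projection hermitian_bloch_state bloch_state_idem)
  then show ?thesis using assms
    by (auto simp: psd_def spec_def matrix_vector_mult_add_rdistrib scaleR_matrix_vector inner_add_right
        intro!: hermitian_add hermitian_scaleR add_nonneg_nonneg mult_nonneg_nonneg)
qed

lemma mat_1_minus_spec: "mat 1 - spec m s1 s2 = spec m (1 - s1) (1 - s2)"
  using bloch_state_uminus[of m] unfolding spec_def by (simp add: algebra_simps)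

lemma scaleR_spec: "c *\<^sub>R spec m s1 s2 = spec m (c * s1) (c * s2)"
  by (simp add: spec_def algebra_simps)

lemma spec_uminus: "spec (- m) s1 s2 = spec m s2 s1"
  by (simp add: spec_def add.commute)

lemma effect_spec:
  assumes "norm m = 1" "0 \<le> s1" "s1 \<le> 1" "0 \<le> s2" "s2 \<le> 1"
  shows "effect (spec m s1 s2)"
  using assms by (simp add: effect_def mat_1_minus_spec psd_spec)

lemma bloch_state_apply:
  assumes "norm m = 1"
  shows "bloch_state m *v (bloch_state m *v w) = bloch_state m *v w"
    "bloch_state (- m) *v (bloch_state (- m) *v w) = bloch_state (- m) *v w"
    "bloch_state m *v (bloch_state (- m) *v w) = 0"
    "bloch_state (- m) *v (bloch_state m *v w) = 0"
  using bloch_state_idem[of m] bloch_state_idem[of "- m"] bloch_state_orth[of m] bloch_state_orth[of "- m"] assms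
  by (simp_all add: matrix_vector_mul_assoc)

lemma spec_vector_mult: "spec m s1 s2 *v v = s1 *\<^sub>R (bloch_state m *v v) + s2 *\<^sub>R (bloch_state (- m) *v v)"
  by (simp add: spec_def matrix_vector_mult_add_rdistrib scaleR_matrix_vector)

lemma spec_apply:
  assumes "norm m = 1"
  shows "spec m s1 s2 *v (bloch_state m *v w) = s1 *\<^sub>R (bloch_state m *v w)"
    "spec m s1 s2 *v (bloch_state (- m) *v w) = s2 *\<^sub>R (bloch_state (- m) *v w)"
  by (simp_all add: spec_vector_mult bloch_state_apply[OF assms])

lemma bloch_state_apply_nonzero: "\<exists>w. bloch_state m *v w \<noteq> 0"
proof (rule ccontr)
  assume "\<not> ?thesis"
  then have "bloch_state m *v w = 0 *v w" for w by simp
  then have "bloch_state m = 0" by (metis matrix_eq)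
  then have "bloch_state m $ 1 $ 1 = 0" "bloch_state m $ 2 $ 2 = 0" by simp_all
  then show False unfolding bloch_state_nth by (simp add: complex_eq_iff)
qed

lemma psd_spec_iff:
  assumes "norm m = 1"
  shows "psd (spec m s1 s2) \<longleftrightarrow> 0 \<le> s1 \<and> 0 \<le> s2"
proof
  assume psd: "psd (spec m s1 s2)"
  obtain w where w: "bloch_state m *v w \<noteq> 0" using bloch_state_apply_nonzero by blast
  obtain w' where w': "bloch_state (- m) *v w' \<noteq> 0" using bloch_state_apply_nonzero by blast
  have "0 \<le> s1 * ((bloch_state m *v w) \<bullet> (bloch_state m *v w))"
    using psd spec_apply(1)[OF assms, of s1 s2 w] unfolding psd_def by (metis inner_scaleR_right)
  moreover have "0 \<le> s2 * ((bloch_state (- m) *v w') \<bullet> (bloch_state (- m) *v w'))"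
    using psd spec_apply(2)[OF assms, of s1 s2 w'] unfolding psd_def by (metis inner_scaleR_right)
  moreover have "0 < (bloch_state m *v w) \<bullet> (bloch_state m *v w)"
    "0 < (bloch_state (- m) *v w') \<bullet> (bloch_state (- m) *v w')"
    using w w' by (simp_all only: inner_gt_zero_iff not_False_eq_True)
  ultimately show "0 \<le> s1 \<and> 0 \<le> s2"
    by (meson mult_neg_pos not_less)
qed (simp add: assms psd_spec)

text \<open>The matrix is \<open>\<alpha>\<close> times the identity plus
  \<open>pauli \<beta>\<close>, with eigenvalues \<open>\<alpha> + norm \<beta>\<close> and
  \<open>\<alpha> - norm \<beta>\<close> along the direction of \<open>\<beta>\<close>. A scalar
  matrix has \<open>\<beta> = 0\<close> and prefers no axis, so an arbitrary unit vector
  \<open>e\<close> serves.\<close>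

lemma hermitian_spec:
  assumes "hermitian A"
  obtains m s1 s2 where "norm m = 1" "A = spec m s1 s2"
proof -
  define \<alpha> where "\<alpha> = Re (A $ 1 $ 1 + A $ 2 $ 2) / 2"
  define \<beta> :: "real^3" where
    "\<beta> = vector [Re (A $ 1 $ 2), - Im (A $ 1 $ 2), Re (A $ 1 $ 1 - A $ 2 $ 2) / 2]"
  obtain e :: "real^3" where e: "norm e = 1" using vector_choose_size[of 1] by auto
  define m where "m = (if \<beta> = 0 then e else (1 / norm \<beta>) *\<^sub>R \<beta>)"
  have m: "norm m = 1" "norm \<beta> *\<^sub>R m = \<beta>" by (auto simp: m_def e)
  have "A = spec m (\<alpha> + norm \<beta>) (\<alpha> - norm \<beta>)"
  proof -
    have "spec m (\<alpha> + norm \<beta>) (\<alpha> - norm \<beta>)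
        = \<alpha> *\<^sub>R (bloch_state m + bloch_state (- m)) + norm \<beta> *\<^sub>R (bloch_state m - bloch_state (- m))"
      by (simp add: spec_def algebra_simps)
    also have "\<dots> = \<alpha> *\<^sub>R mat 1 + norm \<beta> *\<^sub>R pauli m"
      by (simp add: bloch_state_uminus bloch_state_diff)
    also have "\<dots> = \<alpha> *\<^sub>R mat 1 + pauli (norm \<beta> *\<^sub>R m)" by (simp add: pauli_scaleR)
    also have "\<dots> = \<alpha> *\<^sub>R mat 1 + pauli \<beta>" using m(2) by simp
    also have "\<dots> = A" proof -
      have "\<beta> $ 1 = Re (A $ 1 $ 2)" "\<beta> $ 2 = - Im (A $ 1 $ 2)" "\<beta> $ 3 = Re (A $ 1 $ 1 - A $ 2 $ 2) / 2"
        by (simp_all add: \<beta>_def)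
      then show ?thesis unfolding vec_eq_iff forall_2
        using hermitian_nth[OF assms]
        by (simp add: pauli_nth mat_def) (simp add: complex_eq_iff \<alpha>_def field_simps)
    qed
    finally show ?thesis by simp
  qed
  with m(1) show thesis by (intro that[of m "\<alpha> + norm \<beta>" "\<alpha> - norm \<beta>"]) auto
qed

lemma effectE:
  assumes "effect R"
  obtains m s1 s2 where "norm m = 1" "0 \<le> s1" "s1 \<le> 1" "0 \<le> s2" "s2 \<le> 1" "R = spec m s1 s2"
proof -
  have "hermitian R" using assms by (simp add: effect_def psd_def)
  then obtain m s1 s2 where *: "norm m = 1" "R = spec m s1 s2" by (rule hermitian_spec)
  with assms show thesis
    by (intro that[of m s1 s2]) (auto simp: effect_def mat_1_minus_spec psd_spec_iff)
qed

text \<open>Two orthogonal projections with the same range fix each other's values; moving them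
  across the inner product then identifies them. This evaluates the definite description in
  \<open>orth_proj\<close>.\<close>

lemma orth_proj_range:
  assumes "hermitian P" "P ** P = P"
  shows "orth_proj (range ((*v) P)) = P"
  unfolding orth_proj_def
proof (rule the_equality)
  fix Q assume Q: "hermitian Q \<and> Q ** Q = Q \<and> range ((*v) Q) = range ((*v) P)"
  have PQ: "P *v (Q *v v) = Q *v v" for v
  proof -
    obtain w where "Q *v v = P *v w" using Q by (metis imageE rangeI)
    then show ?thesis using assms by (metis matrix_vector_mul_assoc)
  qed
  have QP: "Q *v (P *v v) = P *v v" for v
  proof -
    obtain w where "P *v v = Q *v w" using Q by (metis imageE rangeI)
    then show ?thesis using Q by (metis matrix_vector_mul_assoc)
  qed
  have "v \<bullet> (Q *v w) = v \<bullet> (P *v w)" for v w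
  proof -
    have "v \<bullet> (Q *v w) = (P *v (Q *v v)) \<bullet> w" using Q hermitian_inner PQ by metis
    also have "\<dots> = v \<bullet> (Q *v (P *v w))" using Q assms hermitian_inner by metis
    finally show ?thesis by (simp add: QP)
  qed
  then have *: "Q *v w = P *v w" for w by (metis (no_types) vector_eq_ldot)
  show "Q = P" using * by (simp add: matrix_eq)
qed (use assms in auto)

lemma eigenspace_spec:
  assumes "norm m = 1" "s1 \<noteq> s2"
  shows "eigenspace (spec m s1 s2) l =
    (if l = s1 then range ((*v) (bloch_state m)) else if l = s2 then range ((*v) (bloch_state (- m))) else {0})"
proof -
  let ?P = "bloch_state m" and ?Q = "bloch_state (- m)"
  have split: "v = ?P *v v + ?Q *v v" for v
    using bloch_state_uminus[of m] by (metis matrix_vector_mul_lid matrix_vector_mult_add_rdistrib)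
  have iff: "v \<in> eigenspace (spec m s1 s2) l \<longleftrightarrow> (s1 - l) *\<^sub>R (?P *v v) = 0 \<and> (s2 - l) *\<^sub>R (?Q *v v) = 0" for v
  proof -
    have "v \<in> eigenspace (spec m s1 s2) l \<longleftrightarrow> (s1 - l) *\<^sub>R (?P *v v) + (s2 - l) *\<^sub>R (?Q *v v) = 0"
      unfolding eigenspace_def mem_Collect_eq spec_vector_mult
      by (subst (3) split) (auto simp: algebra_simps)
    \<comment> \<open>Applying each projection isolates one of the two summands, so their sum
      vanishes only if both do.\<close>
    moreover have "?P *v ((s1 - l) *\<^sub>R (?P *v v) + (s2 - l) *\<^sub>R (?Q *v v)) = (s1 - l) *\<^sub>R (?P *v v)"
      "?Q *v ((s1 - l) *\<^sub>R (?P *v v) + (s2 - l) *\<^sub>R (?Q *v v)) = (s2 - l) *\<^sub>R (?Q *v v)"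
      by (simp_all add: matrix_vector_right_distrib scaleR_vector_mult bloch_state_apply[OF assms(1)])
    ultimately show ?thesis by (metis add.right_neutral matrix_vector_mult_0_right)
  qed
  have "v \<in> range ((*v) (bloch_state u)) \<longleftrightarrow> bloch_state (- u) *v v = 0" if "norm u = 1" for u v
  proof
    assume "bloch_state (- u) *v v = 0"
    then have "v = bloch_state u *v v"
      using bloch_state_uminus[of u] by (metis add.right_neutral matrix_vector_mul_lid matrix_vector_mult_add_rdistrib)
    then show "v \<in> range ((*v) (bloch_state u))" by (metis rangeI)
  qed (auto simp: bloch_state_apply[OF that])
  from this[of m] this[of "- m"]
  have rangeP: "v \<in> range ((*v) ?P) \<longleftrightarrow> ?Q *v v = 0" and rangeQ: "v \<in> range ((*v) ?Q) \<longleftrightarrow> ?P *v v = 0" for v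
    by (simp_all add: assms)
  have zero: "v = 0 \<longleftrightarrow> ?P *v v = 0 \<and> ?Q *v v = 0" for v
    using split[of v] by (metis add.right_neutral matrix_vector_mult_0_right)
  show ?thesis
  proof (rule set_eqI)
    fix v
    show "v \<in> eigenspace (spec m s1 s2) l \<longleftrightarrow>
      v \<in> (if l = s1 then range ((*v) ?P) else if l = s2 then range ((*v) ?Q) else {0})"
      using assms(2) zero[of v] unfolding iff by (simp add: rangeP rangeQ)
  qed
qed

lemma orth_proj_bloch_state:
  assumes "norm m = 1"
  shows "orth_proj (range ((*v) (bloch_state m))) = bloch_state m"
  by (intro orth_proj_range hermitian_bloch_state bloch_state_idem assms)

lemma eigvals_spec:
  assumes "norm m = 1" "s1 \<noteq> s2"
  shows "eigvals (spec m s1 s2) = {s1, s2}"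
proof -
  obtain w w' where "bloch_state m *v w \<noteq> 0" "bloch_state (- m) *v w' \<noteq> 0"
    using bloch_state_apply_nonzero by meson
  then show ?thesis
    using assms(2) by (auto simp: eigvals_def eigenspace_spec[OF assms] split: if_splits)
qed

lemma eigenproj_spec:
  assumes "norm m = 1" "s1 \<noteq> s2"
  shows "eigenproj (spec m s1 s2) s1 = bloch_state m" "eigenproj (spec m s1 s2) s2 = bloch_state (- m)"
  using assms by (auto simp: eigenproj_def eigenspace_spec orth_proj_bloch_state)

lemma spectral_projections_spec:
  assumes "norm m = 1" "s1 \<noteq> s2"
  shows "spectral_projections (spec m s1 s2) = pvm m"
  using eigenproj_spec[OF assms]
  by (auto simp: spectral_projections_def eigvals_spec[OF assms] pvm_def bloch_state_def pauli_uminus)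

lemma spec_same: "spec m s s = s *\<^sub>R mat 1"
  by (simp add: spec_def bloch_state_uminus flip: scaleR_right_distrib)

text \<open>Leaving out the kernel amounts to giving it the eigenvalue \<open>ln 0 = 0\<close>, so
  no case distinction on zero eigenvalues survives. Equal eigenvalues are treated apart because the
  eigenprojection is then the identity.\<close>

lemma supp_log_spec:
  assumes "norm m = 1"
  shows "supp_log (spec m s1 s2) = spec m (ln s1) (ln s2)"
proof (cases "s1 = s2")
  case True
  have eig: "eigenspace (spec m s2 s2) l = (if l = s2 then UNIV else {0})" for l
    by (auto simp: eigenspace_def spec_same scaleR_matrix_vector)
  have "eigvals (spec m s2 s2) = {s2}"
  proof -
    obtain v :: "complex^2" where "v \<noteq> 0" using bloch_state_apply_nonzero by blast
    then show ?thesis by (auto simp: eigvals_def eig split: if_splits)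
  qed
  moreover have "eigenproj (spec m s2 s2) s2 = mat 1"
  proof -
    have "hermitian (mat 1)" by (auto simp: hermitian_def cadjoint_def mat_def vec_eq_iff)
    from orth_proj_range[OF this] show ?thesis by (simp add: eigenproj_def eig)
  qed
  ultimately show ?thesis by (cases "s2 = 0") (simp_all add: supp_log_def True spec_same)
next
  case False
  have "supp_log (spec m s1 s2) = (\<Sum>l\<in>{s1, s2}. ln l *\<^sub>R eigenproj (spec m s1 s2) l)"
    unfolding supp_log_def eigvals_spec[OF assms False] by (intro sum.mono_neutral_left) auto
  then show ?thesis
    using False by (simp add: eigenproj_spec[OF assms False] spec_def[of m "ln s1"])
qed

lemma supp_spec:
  assumes "norm m = 1"
  shows "supp (spec m s1 s2) =
    {v. (s1 = 0 \<longrightarrow> bloch_state m *v v = 0) \<and> (s2 = 0 \<longrightarrow> bloch_state (- m) *v v = 0)}"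
proof (intro set_eqI iffI)
  fix v assume "v \<in> supp (spec m s1 s2)"
  then obtain w where "v = spec m s1 s2 *v w" by (auto simp: supp_def)
  then show "v \<in> {v. (s1 = 0 \<longrightarrow> bloch_state m *v v = 0) \<and> (s2 = 0 \<longrightarrow> bloch_state (- m) *v v = 0)}"
    by (auto simp: spec_vector_mult matrix_vector_right_distrib scaleR_vector_mult bloch_state_apply[OF assms])
next
  fix v assume *: "v \<in> {v. (s1 = 0 \<longrightarrow> bloch_state m *v v = 0) \<and> (s2 = 0 \<longrightarrow> bloch_state (- m) *v v = 0)}"
  \<comment> \<open>Since \<open>inverse 0 = 0\<close>, the second factor is the pseudo-inverse, and
    it yields a preimage of \<open>v\<close>.\<close>
  have "spec m s1 s2 *v (spec m (inverse s1) (inverse s2) *v v)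
      = (s1 * inverse s1) *\<^sub>R (bloch_state m *v v) + (s2 * inverse s2) *\<^sub>R (bloch_state (- m) *v v)"
    by (simp add: spec_vector_mult matrix_vector_right_distrib scaleR_vector_mult bloch_state_apply[OF assms]
        mult.commute)
  also have "\<dots> = bloch_state m *v v + bloch_state (- m) *v v"
    using * by auto
  also have "\<dots> = v"
    by (simp add: bloch_state_uminus flip: matrix_vector_mult_add_rdistrib)
  finally show "v \<in> supp (spec m s1 s2)" unfolding supp_def by (metis rangeI)
qed

text \<open>Expanding \<open>(r + m) \<bullet> (r + m)\<close> gives at most 1 - 2 + 1 = 0. Through
  this lemma a vanishing outcome probability forces a pure state opposite to the axis.\<close>

lemma inner_eq_minus_one:
  fixes r m :: "real^3"
  assumes "norm m = 1" "norm r \<le> 1" "1 + r \<bullet> m = 0"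
  shows "r = - m"
proof -
  have "r \<bullet> r \<le> 1" using assms(2) by (simp add: norm_le_square)
  moreover have "m \<bullet> m = 1" using assms(1) by (simp add: dot_square_norm)
  ultimately have "(r + m) \<bullet> (r + m) \<le> 0"
    using assms(3) by (simp add: inner_add_left inner_add_right inner_commute)
  then have "r + m = 0" by (metis inner_ge_zero inner_eq_zero_iff order_antisym)
  then show ?thesis by (simp add: eq_neg_iff_add_eq_0)
qed

text \<open>If the product of the two matrices is 0, so is its trace, the Born probability.
  Conversely probability 0 makes the state the projection orthogonal to
  \<open>bloch_state m\<close>. Support inclusions thus become scalar equations.\<close>

lemma bloch_state_annihilates_iff:
  assumes "norm m = 1" "norm r \<le> 1"
  shows "(\<forall>w. bloch_state m *v (bloch_state r *v w) = 0) \<longleftrightarrow> 1 + r \<bullet> m = 0"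
proof
  assume "\<forall>w. bloch_state m *v (bloch_state r *v w) = 0"
  then have "\<forall>w. (bloch_state m ** bloch_state r) *v w = 0 *v w" by (simp add: matrix_vector_mul_assoc)
  then have "bloch_state m ** bloch_state r = 0" by (simp add: matrix_eq)
  then have "born (bloch_state m) (bloch_state r) = 0" by (simp add: born_def trace_def)
  then show "1 + r \<bullet> m = 0" by (simp add: born_bloch_state inner_commute)
next
  assume "1 + r \<bullet> m = 0"
  then have "r = - m" using inner_eq_minus_one assms by blast
  then show "\<forall>w. bloch_state m *v (bloch_state r *v w) = 0" by (simp add: bloch_state_apply assms)
qed

lemma supp_bloch_state_subset_iff:
  assumes "norm m = 1" "norm r \<le> 1"
  shows "supp (bloch_state r) \<subseteq> supp (spec m s1 s2) \<longleftrightarrow>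
    (s1 = 0 \<longrightarrow> 1 + r \<bullet> m = 0) \<and> (s2 = 0 \<longrightarrow> 1 - r \<bullet> m = 0)"
proof -
  have "supp (bloch_state r) \<subseteq> supp (spec m s1 s2) \<longleftrightarrow>
    (s1 = 0 \<longrightarrow> (\<forall>w. bloch_state m *v (bloch_state r *v w) = 0)) \<and>
    (s2 = 0 \<longrightarrow> (\<forall>w. bloch_state (- m) *v (bloch_state r *v w) = 0))"
    unfolding supp_spec[OF assms(1)] supp_def[of "bloch_state r"] by auto
  then show ?thesis
    using bloch_state_annihilates_iff[OF assms] bloch_state_annihilates_iff[of "- m" r] assms by simp
qed

lemma born_spec: "born (bloch_state r) (spec m s1 s2) = s1 * ((1 + r \<bullet> m) / 2) + s2 * ((1 - r \<bullet> m) / 2)"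
  by (simp add: spec_def born_linear born_bloch_state)

text \<open>In the finite case an eigenvalue 0 or 1 occurs only where the matching probability
  vanishes, so each junk value \<open>ln 0\<close> below is multiplied by 0.\<close>

lemma posterior_fun_spec:
  assumes "norm m = 1" "norm r0 \<le> 1" "norm r1 \<le> 1"
  shows "posterior_fun a b (bloch_state r0) (bloch_state r1) (spec m s1 s2) =
    (if (s1 = 0 \<longrightarrow> 1 + r0 \<bullet> m = 0) \<and> (s2 = 0 \<longrightarrow> 1 - r0 \<bullet> m = 0) \<and>
        (s1 = 1 \<longrightarrow> 1 + r1 \<bullet> m = 0) \<and> (s2 = 1 \<longrightarrow> 1 - r1 \<bullet> m = 0)
     then ereal (a * (ln (s1 / a) * ((1 + r0 \<bullet> m) / 2) + ln (s2 / a) * ((1 - r0 \<bullet> m) / 2)) +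
                 b * (ln ((1 - s1) / b) * ((1 + r1 \<bullet> m) / 2) + ln ((1 - s2) / b) * ((1 - r1 \<bullet> m) / 2)))
     else - \<infinity>)"
  unfolding posterior_fun_def mat_1_minus_spec scaleR_spec
  by (simp add: supp_bloch_state_subset_iff assms supp_log_spec born_spec flip: born_def)

section \<open>POVM elements in Bloch coordinates and the information of a POVM\<close>

lemma psd_born:
  assumes "psd E"
  obtains \<beta> where "norm \<beta> \<le> born (bloch_state 0) E"
    "\<And>r. born (bloch_state r) E = born (bloch_state 0) E + r \<bullet> \<beta>"
proof -
  obtain m s1 s2 where E: "norm m = 1" "E = spec m s1 s2"
    using assms hermitian_spec unfolding psd_def by metis
  then have "0 \<le> s1" "0 \<le> s2" using assms psd_spec_iff by blast+
  \<comment> \<open>The vector has norm \<open>\<bar>s1 - s2\<bar> / 2\<close>, while the maximally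
    mixed state gives \<open>(s1 + s2) / 2\<close>; positivity of the eigenvalues is the comparison
    of the two.\<close>
  with E show thesis
    by (intro that[of "((s1 - s2) / 2) *\<^sub>R m"]) (auto simp: born_spec field_simps abs_if)
qed

text \<open>This is the contribution of one outcome with conditional probabilities \<open>p\<close>
  and \<open>q\<close> to the mutual information. It depends on a single POVM element, which makes
  elementwise bounds possible.\<close>

definition info_term :: "real \<Rightarrow> real \<Rightarrow> real \<Rightarrow> real \<Rightarrow> real" where
  "info_term a b p q = a * p * ln (p / (a * p + b * q)) + b * q * ln (q / (a * p + b * q))"

lemma born_sum_list: "born \<rho> (sum_list M) = (\<Sum>E\<leftarrow>M. born \<rho> E)"
proof (induction M)
  case Nil
  then show ?case by (simp add: born_def trace_def)
qed (simp add: born_linear)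

lemma born_mat_1: "born (bloch_state r) (mat 1) = 1"
  using born_spec[of r 0 1 1] by (simp add: spec_same)

lemma povm_info_eq:
  assumes "a > 0" "b > 0" "povm M"
  shows "povm_info a b (bloch_state r0) (bloch_state r1) M =
    (\<Sum>E\<leftarrow>M. info_term a b (born (bloch_state r0) E) (born (bloch_state r1) E))"
proof -
  have total: "(\<Sum>k<length M. born (bloch_state r) (M ! k)) = 1" for r
    using assms(3) born_sum_list[of "bloch_state r" M]
    by (simp add: povm_def born_mat_1 sum_list_sum_nth atLeast0LessThan)
  show ?thesis
    unfolding povm_info_def mutual_info_def
    using assms(1,2)
    by (simp add: joint_dist_def total sum_list_sum_nth atLeast0LessThan info_term_def sum.distrib
        flip: sum_distrib_left)
qed

text \<open>Weak duality: over a POVM the coordinates \<open>\<alpha>\<close> sum to 1 and the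
  vectors \<open>\<beta>\<close> to 0, so a linear bound on each element leaves \<open>l\<close>.
  The linear function is written with \<open>born (bloch_state v)\<close>, whose formula holds for
  every \<open>v\<close>, whether or not it describes a state; this term already contains one
  \<open>\<alpha>\<close>, hence the factor \<open>l - 1\<close>.\<close>

lemma povm_info_le:
  assumes "a > 0" "b > 0" "povm M"
    and bound: "\<And>\<alpha> \<beta>. norm \<beta> \<le> \<alpha> \<Longrightarrow> info_term a b (\<alpha> + r0 \<bullet> \<beta>) (\<alpha> + r1 \<bullet> \<beta>) \<le> l * \<alpha> + v \<bullet> \<beta>"
  shows "povm_info a b (bloch_state r0) (bloch_state r1) M \<le> l"
proof -
  have "info_term a b (born (bloch_state r0) E) (born (bloch_state r1) E)
      \<le> (l - 1) * born (bloch_state 0) E + born (bloch_state v) E" if E: "E \<in> set M" for E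
  proof -
    have "psd E" using E assms(3) by (simp add: povm_def)
    then obtain \<beta> where \<beta>: "norm \<beta> \<le> born (bloch_state 0) E"
      and born: "\<And>r. born (bloch_state r) E = born (bloch_state 0) E + r \<bullet> \<beta>" by (rule psd_born) blast
    show ?thesis
      using bound[OF \<beta>] by (simp add: born[of r0] born[of r1] born[of v] algebra_simps)
  qed
  then have "povm_info a b (bloch_state r0) (bloch_state r1) M
      \<le> (\<Sum>E\<leftarrow>M. (l - 1) * born (bloch_state 0) E + born (bloch_state v) E)"
    unfolding povm_info_eq[OF assms(1-3)] by (rule sum_list_mono)
  also have "\<dots> = (l - 1) * born (bloch_state 0) (sum_list M) + born (bloch_state v) (sum_list M)"
    by (simp add: born_sum_list sum_list_addf sum_list_const_mult)
  also have "\<dots> = l"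
    using assms(3) by (simp add: povm_def born_mat_1)
  finally show ?thesis .
qed

lemma povm_pvm:
  assumes "norm m = 1"
  shows "povm [bloch_state m, bloch_state (- m)]"
  using assms psd_spec[of m 1 0] psd_spec[of m 0 1] by (simp add: povm_def bloch_state_uminus spec_def)

lemma axis_prob_bounds:
  fixes r n :: "real^3"
  assumes "norm r \<le> 1" "norm n = 1"
  shows "0 \<le> axis_prob r n" "axis_prob r n \<le> 1"
proof -
  have "\<bar>r \<bullet> n\<bar> \<le> norm r * norm n" by (rule Cauchy_Schwarz_ineq2)
  with assms have "\<bar>r \<bullet> n\<bar> \<le> 1" by simp
  then show "0 \<le> axis_prob r n" "axis_prob r n \<le> 1" by (auto simp: axis_prob_def)
qed

lemma info_term_eq:
  assumes "a > 0" "b > 0" "p \<ge> 0" "q \<ge> 0"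
  shows "info_term a b p q = a * p * ln p + b * q * ln q - (a * p + b * q) * ln (a * p + b * q)"
proof -
  have "a * p * ln (p / (a * p + b * q)) = a * p * (ln p - ln (a * p + b * q))"
  proof (cases "p = 0")
    case False
    then have "0 < p" "0 < a * p + b * q" using assms by (auto intro: add_pos_nonneg)
    then show ?thesis by (simp add: ln_div)
  qed simp
  moreover have "b * q * ln (q / (a * p + b * q)) = b * q * (ln q - ln (a * p + b * q))"
  proof (cases "q = 0")
    case False
    then have "0 < q" "0 < a * p + b * q" using assms by (auto intro: add_nonneg_pos)
    then show ?thesis by (simp add: ln_div)
  qed simp
  ultimately show ?thesis by (simp add: info_term_def algebra_simps)
qed

lemma axis_info_eq:
  assumes "a > 0" "b > 0" "a + b = 1" "norm r0 \<le> 1" "norm r1 \<le> 1" "norm n = 1"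
  shows "axis_info a b r0 r1 n =
    info_term a b (axis_prob r0 n) (axis_prob r1 n) + info_term a b (1 - axis_prob r0 n) (1 - axis_prob r1 n)"
proof -
  have w: "a * (1 - p) + b * (1 - q) = 1 - (a * p + b * q)" for p q
    using assms(3) by (simp add: algebra_simps)
  show ?thesis
    using assms axis_prob_bounds[of r0 n] axis_prob_bounds[of r1 n]
    by (simp add: info_term_eq w axis_info_def bin_entropy_def) (simp add: algebra_simps)
qed

lemma povm_info_pvm:
  assumes "a > 0" "b > 0" "a + b = 1" "norm r0 \<le> 1" "norm r1 \<le> 1" "norm n = 1"
  shows "povm_info a b (bloch_state r0) (bloch_state r1) [bloch_state n, bloch_state (- n)] = axis_info a b r0 r1 n"
proof -
  have "born (bloch_state r) (bloch_state n) = axis_prob r n"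
    "born (bloch_state r) (bloch_state (- n)) = 1 - axis_prob r n" for r
    by (simp_all add: born_bloch_state axis_prob_def field_simps)
  then show ?thesis
    by (simp add: povm_info_eq povm_pvm axis_info_eq assms)
qed

section \<open>The tangent inequality for the logarithm\<close>

lemma quadratic_form_nonneg:
  fixes A B D u v :: real
  assumes "A \<ge> 0" "B \<ge> 0" "D\<^sup>2 \<le> A * B"
  shows "0 \<le> A * u\<^sup>2 + B * v\<^sup>2 + 2 * D * u * v"
proof (cases "A = 0")
  case True
  with assms have "D = 0" by simp
  with True assms show ?thesis by simp
next
  case False
  have "A * (A * u\<^sup>2 + B * v\<^sup>2 + 2 * D * u * v) = (A * u + D * v)\<^sup>2 + (A * B - D\<^sup>2) * v\<^sup>2"
    by (simp add: power2_eq_square algebra_simps)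
  also have "\<dots> \<ge> 0" using assms by simp
  finally show ?thesis using False assms(1) by (simp add: zero_le_mult_iff)
qed

text \<open>For \<open>t = 0\<close> this is a quadratic form in the second-order remainders of the logarithm, where
  \<open>x\<close> and \<open>y\<close> are the eigenvalues of the base point and \<open>s\<close> is an eigenvalue of the other operator.
  Shifting all three eigenvalues by \<open>t\<close> makes it decrease to \<open>0\<close>, because its derivative in \<open>t\<close> is
  minus a positive semidefinite form; the value at \<open>t = 0\<close> is therefore nonnegative. This replaces the
  integral representation in the proof that the logarithm is operator concave.\<close>

definition log_gap :: "real \<Rightarrow> real \<Rightarrow> real \<Rightarrow> real \<Rightarrow> real \<Rightarrow> real \<Rightarrow> real \<Rightarrow> real" where
  "log_gap A B D x y s t =
     A * ((s - x) / (x + t) + ln (x + t)) + B * ((s - y) / (y + t) + ln (y + t))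
       + 2 * D * ((s - x) * ((ln (x + t) - ln (y + t)) / (x - y)) + ln (x + t))
       - (A + B + 2 * D) * ln (s + t)"

text \<open>The coefficient of \<open>ln (s + t)\<close> is the total weight
  \<open>A + B + 2 * D\<close>, so it can be distributed over the three brackets. Each logarithm
  then appears in a difference that tends to 0.\<close>

lemma log_gap_tendsto: "(log_gap A B D x y s \<longlongrightarrow> 0) at_top"
proof -
  have ln: "((\<lambda>t. ln (u + t) - ln (v + t)) \<longlongrightarrow> 0) at_top" for u v :: real
    by real_asymp
  have quot: "((\<lambda>t. c / (u + t)) \<longlongrightarrow> 0) at_top" for c u :: real
    by real_asymp
  have "((\<lambda>t. A * ((s - x) / (x + t) + (ln (x + t) - ln (s + t))) + B * ((s - y) / (y + t) + (ln (y + t) - ln (s + t)))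
       + 2 * D * ((s - x) * ((ln (x + t) - ln (y + t)) / (x - y)) + (ln (x + t) - ln (s + t))))
     \<longlongrightarrow> A * (0 + 0) + B * (0 + 0) + 2 * D * ((s - x) * 0 + 0)) at_top"
    by (intro tendsto_add tendsto_mult tendsto_const ln quot tendsto_divide_zero)
  moreover have "log_gap A B D x y s = (\<lambda>t. A * ((s - x) / (x + t) + (ln (x + t) - ln (s + t)))
       + B * ((s - y) / (y + t) + (ln (y + t) - ln (s + t)))
       + 2 * D * ((s - x) * ((ln (x + t) - ln (y + t)) / (x - y)) + (ln (x + t) - ln (s + t))))"
    by (simp add: log_gap_def fun_eq_iff algebra_simps)
  ultimately show ?thesis by simp
qed

text \<open>The divided difference of the logarithm has the derivative
  \<open>- 1 / ((x + t) * (y + t))\<close>, the polarized form of the diagonal one. Hence the three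
  brackets combine into one quadratic form in the relative deviations of \<open>s\<close> from
  \<open>x\<close> and \<open>y\<close>.\<close>

lemma log_gap_deriv:
  assumes "x + t > 0" "y + t > 0" "s + t > 0" "x \<noteq> y"
  shows "(log_gap A B D x y s has_real_derivative
    - (A * ((x - s) / (x + t))\<^sup>2 + B * ((y - s) / (y + t))\<^sup>2
       + 2 * D * ((x - s) / (x + t)) * ((y - s) / (y + t))) / (s + t)) (at t)"
proof -
  have sq: "- (s - z) / (z + t)\<^sup>2 + 1 / (z + t) - 1 / (s + t) = - ((z - s) / (z + t))\<^sup>2 / (s + t)"
    if "z + t > 0" for z
    using that assms(3) by (simp add: divide_simps power2_eq_square) algebra
  have mixed: "(s - x) * ((1 / (x + t) - 1 / (y + t)) / (x - y)) + 1 / (x + t) - 1 / (s + t)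
      = - ((x - s) / (x + t)) * ((y - s) / (y + t)) / (s + t)"
  proof -
    have "(1 / (x + t) - 1 / (y + t)) / (x - y) = - 1 / ((x + t) * (y + t))"
      using assms by (simp add: divide_simps)
    then show ?thesis using assms by (simp only:) (simp add: divide_simps, simp add: algebra_simps)
  qed
  have collect: "A * (- U / S) + B * (- V / S) + 2 * D * (- u * v / S) = - (A * U + B * V + 2 * D * u * v) / S"
    for U V u v S :: real
    by (simp add: add_divide_distrib diff_divide_distrib algebra_simps)
  have "(log_gap A B D x y s has_real_derivative
      A * (- (s - x) / (x + t)\<^sup>2 + 1 / (x + t)) + B * (- (s - y) / (y + t)\<^sup>2 + 1 / (y + t))
       + 2 * D * ((s - x) * ((1 / (x + t) - 1 / (y + t)) / (x - y)) + 1 / (x + t))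
       - (A + B + 2 * D) * (1 / (s + t))) (at t)"
    unfolding log_gap_def using assms
    by (auto intro!: derivative_eq_intros simp: power2_eq_square)
  also have "A * (- (s - x) / (x + t)\<^sup>2 + 1 / (x + t)) + B * (- (s - y) / (y + t)\<^sup>2 + 1 / (y + t))
       + 2 * D * ((s - x) * ((1 / (x + t) - 1 / (y + t)) / (x - y)) + 1 / (x + t))
       - (A + B + 2 * D) * (1 / (s + t))
    = A * (- (s - x) / (x + t)\<^sup>2 + 1 / (x + t) - 1 / (s + t)) + B * (- (s - y) / (y + t)\<^sup>2 + 1 / (y + t) - 1 / (s + t))
       + 2 * D * ((s - x) * ((1 / (x + t) - 1 / (y + t)) / (x - y)) + 1 / (x + t) - 1 / (s + t))"
    by (simp add: algebra_simps)
  also have "\<dots> = - (A * ((x - s) / (x + t))\<^sup>2 + B * ((y - s) / (y + t))\<^sup>2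
       + 2 * D * ((x - s) / (x + t)) * ((y - s) / (y + t))) / (s + t)"
    unfolding mixed sq[OF assms(1)] sq[OF assms(2)] by (rule collect)
  finally show ?thesis .
qed

lemma log_gap_pos:
  fixes A B D x y s :: real
  assumes "x > 0" "y > 0" "x \<noteq> y" "A \<ge> 0" "B \<ge> 0" "D\<^sup>2 \<le> A * B" "s \<ge> 0"
    and s0: "s = 0 \<Longrightarrow> A + B + 2 * D = 0"
  shows "0 \<le> log_gap A B D x y s 0"
    and "log_gap A B D x y s 0 = 0 \<Longrightarrow> A * (x - s)\<^sup>2 = 0 \<and> B * (y - s)\<^sup>2 = 0"
proof -
  let ?g = "log_gap A B D x y s"
  let ?q = "\<lambda>t. A * ((x - s) / (x + t))\<^sup>2 + B * ((y - s) / (y + t))\<^sup>2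
       + 2 * D * ((x - s) / (x + t)) * ((y - s) / (y + t))"
  have deriv: "(?g has_real_derivative - ?q t / (s + t)) (at t)" if "t > 0" for t
    using that assms by (intro log_gap_deriv) auto
  \<comment> \<open>For \<open>s = 0\<close> the term \<open>ln (s + t)\<close> is singular at
    \<open>t = 0\<close>, but its total weight is 0 by \<open>s0\<close>.\<close>
  have cont: "continuous_on {0..} ?g"
  proof (cases "s = 0")
    case True
    then show ?thesis unfolding log_gap_def using assms s0
      by (auto intro!: continuous_intros simp del: ln_mult) 
  next
    case False
    then show ?thesis unfolding log_gap_def using assms by (auto intro!: continuous_intros)
  qed
  have decreasing: "?g v \<le> ?g u" if "0 \<le> u" "u \<le> v" for u v
  proof (rule DERIV_nonpos_imp_decreasing_open[OF \<open>u \<le> v\<close>])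
    fix t assume "u < t" "t < v"
    with that have "t > 0" by simp
    moreover have "0 \<le> ?q t" using assms by (intro quadratic_form_nonneg)
    ultimately have "- ?q t / (s + t) \<le> 0" using assms by (simp add: divide_le_0_iff)
    then show "\<exists>d. (?g has_real_derivative d) (at t) \<and> d \<le> 0" using deriv[OF \<open>t > 0\<close>] by blast
  qed (use cont that in \<open>auto intro: continuous_on_subset\<close>)
  have nonneg: "0 \<le> ?g u" if "u \<ge> 0" for u
    using log_gap_tendsto
  proof (rule tendsto_upperbound)
    show "\<forall>\<^sub>F t in at_top. ?g t \<le> ?g u"
      using eventually_ge_at_top[of u] by eventually_elim (use decreasing that in auto)
  qed simp
  show "0 \<le> ?g 0" by (simp add: nonneg)
  assume 0: "?g 0 = 0"
  have "?g u = 0" if "u \<ge> 0" for u using nonneg[of u] decreasing[of 0 u] 0 that by simp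
  then have q0: "?q t = 0" if "t > 0" for t
  proof -
    have "((\<lambda>_. 0) has_real_derivative - ?q t / (s + t)) (at t)"
      using deriv[OF that] \<open>\<And>u. u \<ge> 0 \<Longrightarrow> ?g u = 0\<close> that
      by (rule_tac DERIV_cong_ev[THEN iffD1, rotated 3])
        (auto intro: eventually_nhds_in_open[of "{0<..}", THEN eventually_mono])
    then have "- ?q t / (s + t) = 0" using DERIV_unique DERIV_const by blast
    with that assms show ?thesis by simp
  qed
  define P where "P = A * (x - s)\<^sup>2"
  define Q where "Q = B * (y - s)\<^sup>2"
  define E where "E = D * (x - s) * (y - s)"
  \<comment> \<open>A zero gap at 0 keeps the gap 0 on the half-line, so its derivative vanishes
    there. Clearing denominators makes this a quadratic polynomial in \<open>t\<close>.\<close>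
  have eq: "P * (y + t)\<^sup>2 + Q * (x + t)\<^sup>2 + 2 * E * (x + t) * (y + t) = 0" if "t > 0" for t
  proof -
    have "x + t \<noteq> 0" "y + t \<noteq> 0" using assms that by auto
    then have "P * (y + t)\<^sup>2 + Q * (x + t)\<^sup>2 + 2 * E * (x + t) * (y + t) = ?q t * ((x + t) * (y + t))\<^sup>2"
      unfolding P_def Q_def E_def by (simp add: divide_simps power2_eq_square)
    then show ?thesis using q0[OF that] by simp
  qed
  \<comment> \<open>Three zeros kill all three coefficients of a quadratic polynomial.\<close>
  have *: "P + Q + 2 * E = 0" "P * y + Q * x + E * (x + y) = 0" "P * y\<^sup>2 + Q * x\<^sup>2 + 2 * E * x * y = 0"
    using eq[of 1] eq[of 2] eq[of 3] by (simp_all add: power2_eq_square algebra_simps)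
  have "(P - Q) * (x - y) = 0" using *(1,2) by algebra
  then have "P = Q" using assms by simp
  moreover have "P * (x - y)\<^sup>2 = 0" using *(1,3) \<open>P = Q\<close> by algebra
  ultimately show "P = 0 \<and> Q = 0" using assms by simp
qed

text \<open>With \<open>z = s / y\<close> the expression is \<open>y * (z - 1 - ln z)\<close>. This
  scalar case serves at singular base points and again for the nonnegativity of the
  information.\<close>

lemma log_tangent:
  fixes s y :: real
  assumes "s > 0" "y > 0"
  shows "0 \<le> s - y + y * ln y - y * ln s" and "s - y + y * ln y - y * ln s = 0 \<Longrightarrow> s = y"
proof -
  have eq: "s - y + y * ln y - y * ln s = y * (s / y - 1 - ln (s / y))"
    using assms by (simp add: ln_div algebra_simps)
  show "0 \<le> s - y + y * ln y - y * ln s"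
    unfolding eq using assms ln_le_minus_one[of "s / y"] by simp
  assume "s - y + y * ln y - y * ln s = 0"
  then have "ln (s / y) = s / y - 1" using assms unfolding eq by simp
  then have "s / y = 1" using assms ln_eq_minus_one[of "s / y"] by simp
  then show "s = y" by simp
qed

text \<open>The diagonal weights are \<open>P * x\<close> and \<open>Q * y\<close>: with the factors \<open>x\<close> and \<open>y\<close> split off, no division
  by an eigenvalue occurs, and the base point may be singular.\<close>

definition tangent_gap :: "real \<Rightarrow> real \<Rightarrow> real \<Rightarrow> real \<Rightarrow> real \<Rightarrow> real \<Rightarrow> real" where
  "tangent_gap P Q D x y s =
     P * (s - x + x * ln x) + Q * (s - y + y * ln y)
       + 2 * D * ((s - x) * ((ln x - ln y) / (x - y)) + ln x) - (P * x + Q * y + 2 * D) * ln s"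

text \<open>If one eigenvalue of the base point is 0, the bound on \<open>D\<close> forces
  \<open>D = 0\<close>; the gap splits into a linear term for that eigenvalue and the scalar gap for
  the other, which is positive because \<open>x \<noteq> y\<close>. Otherwise
  \<open>log_gap_pos\<close> applies.\<close>

lemma tangent_gap_nonneg:
  fixes P Q D x y s :: real
  assumes "x \<ge> 0" "y \<ge> 0" "x \<noteq> y" "P \<ge> 0" "Q \<ge> 0" "D\<^sup>2 \<le> (P * x) * (Q * y)" "s \<ge> 0"
    and s0: "s = 0 \<Longrightarrow> P * x + Q * y + 2 * D = 0"
  shows "0 \<le> tangent_gap P Q D x y s \<and>
    (tangent_gap P Q D x y s = 0 \<longrightarrow> P * (x - s)\<^sup>2 = 0 \<and> Q * (y - s)\<^sup>2 = 0)"
proof -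
  have edge: "0 \<le> P * s + Q * (s - y + y * ln y - y * ln s) \<and>
      (P * s + Q * (s - y + y * ln y - y * ln s) = 0 \<longrightarrow> P * s\<^sup>2 = 0 \<and> Q * (y - s)\<^sup>2 = 0)"
    if "y > 0" "P \<ge> 0" "Q \<ge> 0" and s0: "s = 0 \<Longrightarrow> Q * y = 0" for P Q y
  proof (cases "s = 0")
    case False
    then have "s > 0" using assms by simp
    note * = log_tangent[OF this \<open>y > 0\<close>]
    have "0 \<le> P * s" "0 \<le> Q * (s - y + y * ln y - y * ln s)"
      using that * \<open>s > 0\<close> by simp_all
    then show ?thesis
      using that * \<open>s > 0\<close> by (auto simp: add_nonneg_eq_0_iff)
  qed (use that in auto)
  consider "x = 0" "y > 0" | "y = 0" "x > 0" | "x > 0" "y > 0"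
    using assms(1-3) by linarith
  then show ?thesis
  proof cases
    case 1
    then have "D = 0" using assms by simp
    then show ?thesis using edge[of y P Q] 1 assms by (simp add: tangent_gap_def algebra_simps)
  next
    case 2
    then have "D = 0" using assms by simp
    then show ?thesis using edge[of x Q P] 2 assms by (simp add: tangent_gap_def algebra_simps)
  next
    case 3
    have "tangent_gap P Q D x y s = log_gap (P * x) (Q * y) D x y s 0"
      using 3 by (simp add: tangent_gap_def log_gap_def field_simps)
    moreover have "0 \<le> log_gap (P * x) (Q * y) D x y s 0"
      by (rule log_gap_pos(1)) (use assms 3 in auto)
    moreover have "(P * x) * (x - s)\<^sup>2 = 0 \<and> (Q * y) * (y - s)\<^sup>2 = 0" if "log_gap (P * x) (Q * y) D x y s 0 = 0"
      by (rule log_gap_pos(2)) (use assms 3 that in auto)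
    ultimately show ?thesis using 3 by auto
  qed
qed

lemma inner_sq_orthonormal_le:
  fixes n t u :: "'a::real_inner"
  assumes "norm n = 1" "norm t = 1" "t \<bullet> n = 0"
  shows "(u \<bullet> n)\<^sup>2 + (u \<bullet> t)\<^sup>2 \<le> (norm u)\<^sup>2"
proof -
  have *: "n \<bullet> n = 1" "t \<bullet> t = 1" "n \<bullet> t = 0" using assms by (simp_all add: dot_square_norm inner_commute)
  have "0 \<le> (u - (u \<bullet> n) *\<^sub>R n - (u \<bullet> t) *\<^sub>R t) \<bullet> (u - (u \<bullet> n) *\<^sub>R n - (u \<bullet> t) *\<^sub>R t)" by simp
  also have "\<dots> = (norm u)\<^sup>2 - ((u \<bullet> n)\<^sup>2 + (u \<bullet> t)\<^sup>2)"
    by (simp add: inner_diff_left inner_diff_right * assms(3) inner_commute[of n u] inner_commute[of t u]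
        power2_norm_eq_inner) (simp add: power2_eq_square)
  finally show ?thesis by simp
qed

section \<open>Posteriors and the certificate at a stationary axis\<close>

locale qubit_ensemble =
  fixes a b :: real and r0 r1 :: "real^3"
  assumes a: "a > 0" and b: "b > 0" and ab: "a + b = 1"
    and r0: "norm r0 \<le> 1" and r1: "norm r1 \<le> 1" and distinct: "r0 \<noteq> r1"
begin

definition outcome :: "real^3 \<Rightarrow> real" where
  "outcome n = a * axis_prob r0 n + b * axis_prob r1 n"

definition post_plus :: "real^3 \<Rightarrow> real" where
  "post_plus n = a * axis_prob r0 n / outcome n"

definition post_minus :: "real^3 \<Rightarrow> real" where
  "post_minus n = a * (1 - axis_prob r0 n) / (1 - outcome n)"

lemma axis_prob_zero: "norm r \<le> 1 \<Longrightarrow> norm n = 1 \<Longrightarrow> axis_prob r n = 0 \<Longrightarrow> r = - n"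
  by (rule inner_eq_minus_one) (auto simp: axis_prob_def)

lemma axis_prob_one: "norm r \<le> 1 \<Longrightarrow> norm n = 1 \<Longrightarrow> axis_prob r n = 1 \<Longrightarrow> r = n"
  using axis_prob_zero[of r "- n"] by (simp add: axis_prob_def)

context
  fixes n :: "real^3"
  assumes n: "norm n = 1"
begin

lemma outcome_compl: "1 - outcome n = a * (1 - axis_prob r0 n) + b * (1 - axis_prob r1 n)"
  using ab by (simp add: outcome_def algebra_simps)

text \<open>An outcome of probability 0 would make both states the pure state opposite to
  \<open>n\<close>, against \<open>r0 \<noteq> r1\<close>. With \<open>outcome_less\<close> this
  makes the posteriors genuine quotients, even for pure states.\<close>

lemma outcome_pos: "0 < outcome n"
proof -
  have "axis_prob r0 n \<noteq> 0 \<or> axis_prob r1 n \<noteq> 0"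
    using axis_prob_zero r0 r1 n distinct by blast
  then show ?thesis
    using axis_prob_bounds[OF r0 n] axis_prob_bounds[OF r1 n] a b
    by (auto simp: outcome_def intro: add_pos_nonneg add_nonneg_pos)
qed

lemma outcome_less: "outcome n < 1"
proof -
  have "axis_prob r0 n \<noteq> 1 \<or> axis_prob r1 n \<noteq> 1"
    using axis_prob_one r0 r1 n distinct by blast
  then have "0 < 1 - outcome n"
    unfolding outcome_compl
    using axis_prob_bounds[OF r0 n] axis_prob_bounds[OF r1 n] a b
    by (auto intro: add_pos_nonneg add_nonneg_pos)
  then show ?thesis by simp
qed

lemma posterior_mult:
  "outcome n * post_plus n = a * axis_prob r0 n"
  "outcome n * (1 - post_plus n) = b * axis_prob r1 n"
  "(1 - outcome n) * post_minus n = a * (1 - axis_prob r0 n)"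
  "(1 - outcome n) * (1 - post_minus n) = b * (1 - axis_prob r1 n)"
proof -
  show *: "outcome n * post_plus n = a * axis_prob r0 n"
    "(1 - outcome n) * post_minus n = a * (1 - axis_prob r0 n)"
    using outcome_pos outcome_less by (simp_all add: post_plus_def post_minus_def)
  have "outcome n * (1 - post_plus n) = outcome n - a * axis_prob r0 n"
    unfolding *[symmetric] by (simp add: algebra_simps)
  then show "outcome n * (1 - post_plus n) = b * axis_prob r1 n" by (simp add: outcome_def)
  have "(1 - outcome n) * (1 - post_minus n) = (1 - outcome n) - a * (1 - axis_prob r0 n)"
    unfolding *[symmetric] by (simp add: algebra_simps)
  then show "(1 - outcome n) * (1 - post_minus n) = b * (1 - axis_prob r1 n)" by (simp add: outcome_compl)
qed

lemma posterior_bounds: "0 \<le> post_plus n" "post_plus n \<le> 1" "0 \<le> post_minus n" "post_minus n \<le> 1"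
proof -
  have "0 \<le> outcome n * post_plus n" "0 \<le> outcome n * (1 - post_plus n)"
    "0 \<le> (1 - outcome n) * post_minus n" "0 \<le> (1 - outcome n) * (1 - post_minus n)"
    unfolding posterior_mult using axis_prob_bounds[OF r0 n] axis_prob_bounds[OF r1 n] a b by simp_all
  then show "0 \<le> post_plus n" "post_plus n \<le> 1" "0 \<le> post_minus n" "post_minus n \<le> 1"
    using outcome_pos outcome_less by (simp_all add: zero_le_mult_iff)
qed

lemma posterior_zero_iff:
  "post_plus n = 0 \<longleftrightarrow> axis_prob r0 n = 0" "post_plus n = 1 \<longleftrightarrow> axis_prob r1 n = 0"
  "post_minus n = 0 \<longleftrightarrow> axis_prob r0 n = 1" "post_minus n = 1 \<longleftrightarrow> axis_prob r1 n = 1"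
  using posterior_mult outcome_pos outcome_less a b by auto

lemma posterior_eq_iff: "post_plus n = post_minus n \<longleftrightarrow> (r0 - r1) \<bullet> n = 0"
proof -
  have "post_plus n = post_minus n \<longleftrightarrow>
      outcome n * post_plus n * (1 - outcome n) = (1 - outcome n) * post_minus n * outcome n"
    using outcome_pos outcome_less by auto
  also have "\<dots> \<longleftrightarrow> a * axis_prob r0 n * (1 - outcome n) = a * (1 - axis_prob r0 n) * outcome n"
    unfolding posterior_mult ..
  also have "\<dots> \<longleftrightarrow> axis_prob r0 n = outcome n" using a by (simp add: algebra_simps)
  also have "\<dots> \<longleftrightarrow> b * (axis_prob r0 n - axis_prob r1 n) = 0"
  proof -
    have "axis_prob r0 n - outcome n = (a + b) * axis_prob r0 n - outcome n" by (simp add: ab)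
    also have "\<dots> = b * (axis_prob r0 n - axis_prob r1 n)" by (simp add: outcome_def algebra_simps)
    finally show ?thesis by (metis right_minus_eq)
  qed
  also have "\<dots> \<longleftrightarrow> (r0 - r1) \<bullet> n = 0" using b by (auto simp: axis_prob_def inner_diff_left)
  finally show ?thesis .
qed

lemma info_eq_posterior:
  "axis_info a b r0 r1 n =
    a * (axis_prob r0 n * ln (post_plus n / a) + (1 - axis_prob r0 n) * ln (post_minus n / a)) +
    b * (axis_prob r1 n * ln ((1 - post_plus n) / b) + (1 - axis_prob r1 n) * ln ((1 - post_minus n) / b))"
proof -
  have "post_plus n / a = axis_prob r0 n / outcome n" "(1 - post_plus n) / b = axis_prob r1 n / outcome n"
    "post_minus n / a = (1 - axis_prob r0 n) / (1 - outcome n)"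
    "(1 - post_minus n) / b = (1 - axis_prob r1 n) / (1 - outcome n)"
    using posterior_mult outcome_pos outcome_less a b by (simp_all add: field_simps)
  then show ?thesis
    by (simp add: axis_info_eq[OF a b ab r0 r1 n] info_term_def outcome_def[symmetric] outcome_compl[symmetric])
       (simp add: algebra_simps)
qed

lemma posterior_fun_axis:
  "posterior_fun a b (bloch_state r0) (bloch_state r1) (spec n (post_plus n) (post_minus n)) =
    ereal (axis_info a b r0 r1 n)"
proof -
  have *: "1 + r \<bullet> n = 0 \<longleftrightarrow> axis_prob r n = 0" "1 - r \<bullet> n = 0 \<longleftrightarrow> axis_prob r n = 1"
    "(1 + r \<bullet> n) / 2 = axis_prob r n" "(1 - r \<bullet> n) / 2 = 1 - axis_prob r n" for r
    by (auto simp: axis_prob_def field_simps)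
  show ?thesis
    unfolding posterior_fun_spec[OF n r0 r1] * posterior_zero_iff info_eq_posterior by (simp add: mult.commute)
qed

lemma effect_axis: "effect (spec n (post_plus n) (post_minus n))"
  by (intro effect_spec n posterior_bounds)

end

text \<open>The expected logarithmic score of announcing the posterior \<open>s\<close> on a POVM
  element, without normalization by the priors. That omission is why
  \<open>a * ln a + b * ln b\<close> accompanies the information below.\<close>

definition payoff :: "real \<Rightarrow> real^3 \<Rightarrow> real \<Rightarrow> real" where
  "payoff \<alpha> \<beta> s = a * (\<alpha> + r0 \<bullet> \<beta>) * ln s + b * (\<alpha> + r1 \<bullet> \<beta>) * ln (1 - s)"

text \<open>Twice the derivative of the information at \<open>n\<close> in the direction \<open>t\<close>. A posterior \<open>0\<close> or \<open>1\<close> occurs only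
  if a Bloch vector is \<open>n\<close> or \<open>- n\<close>, and then the factor of the junk value \<open>ln 0\<close> vanishes.\<close>

definition slope :: "real^3 \<Rightarrow> real^3 \<Rightarrow> real" where
  "slope n t = a * (r0 \<bullet> t) * (ln (post_plus n) - ln (post_minus n))
     + b * (r1 \<bullet> t) * (ln (1 - post_plus n) - ln (1 - post_minus n))"

lemma ln_shift: "c * ln (s / k) = c * ln s - c * ln k" if "k > 0" "s \<ge> 0" "s = 0 \<Longrightarrow> c = 0" for c s k :: real
  using that by (cases "s = 0") (auto simp: ln_div algebra_simps)

text \<open>An effect with Bloch data \<open>(\<alpha>, \<beta>)\<close> that is assigned the posterior \<open>s\<close> earns at most a linear function
  of \<open>(\<alpha>, \<beta>)\<close>. Summing over the spectral projections of an effect bounds the posterior functional, and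
  summing over a POVM bounds its information.\<close>

definition certifies :: "real^3 \<Rightarrow> real^3 \<Rightarrow> bool" where
  "certifies n v \<longleftrightarrow> (\<forall>\<alpha> \<beta> s. norm \<beta> \<le> \<alpha> \<longrightarrow> 0 \<le> s \<longrightarrow> s \<le> 1 \<longrightarrow>
      (s = 0 \<longrightarrow> \<alpha> + r0 \<bullet> \<beta> = 0) \<longrightarrow> (s = 1 \<longrightarrow> \<alpha> + r1 \<bullet> \<beta> = 0) \<longrightarrow>
      payoff \<alpha> \<beta> s \<le> (axis_info a b r0 r1 n + a * ln a + b * ln b) * \<alpha> + v \<bullet> \<beta> \<and>
      (payoff \<alpha> \<beta> s = (axis_info a b r0 r1 n + a * ln a + b * ln b) * \<alpha> + v \<bullet> \<beta> \<longrightarrow>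
        (\<alpha> + \<beta> \<bullet> n) * (post_plus n - s) = 0 \<and> (\<alpha> - \<beta> \<bullet> n) * (post_minus n - s) = 0))"

lemma certifiesD:
  assumes "certifies n v" "norm \<beta> \<le> \<alpha>" "0 \<le> s" "s \<le> 1"
    "s = 0 \<Longrightarrow> \<alpha> + r0 \<bullet> \<beta> = 0" "s = 1 \<Longrightarrow> \<alpha> + r1 \<bullet> \<beta> = 0"
  shows "payoff \<alpha> \<beta> s \<le> (axis_info a b r0 r1 n + a * ln a + b * ln b) * \<alpha> + v \<bullet> \<beta> \<and>
      (payoff \<alpha> \<beta> s = (axis_info a b r0 r1 n + a * ln a + b * ln b) * \<alpha> + v \<bullet> \<beta> \<longrightarrow>
        (\<alpha> + \<beta> \<bullet> n) * (post_plus n - s) = 0 \<and> (\<alpha> - \<beta> \<bullet> n) * (post_minus n - s) = 0)"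
  using assms unfolding certifies_def by blast

text \<open>The difference between the linear function and the payoff is a sum of two tangent gaps,
  one for the operator with the first letter and one for its complement with the second. Their
  off-diagonal first-order terms cancel by stationarity.\<close>

lemma certificate:
  assumes n: "norm n = 1" and t: "norm t = 1" "t \<bullet> n = 0"
    and r0t: "r0 = (r0 \<bullet> n) *\<^sub>R n + (r0 \<bullet> t) *\<^sub>R t" and r1t: "r1 = (r1 \<bullet> n) *\<^sub>R n + (r1 \<bullet> t) *\<^sub>R t"
    and ne: "(r0 - r1) \<bullet> n \<noteq> 0" and slope: "slope n t = 0"
  shows "\<exists>v. certifies n v"
proof -
  define x where "x = post_plus n"
  define y where "y = post_minus n"
  define w where "w = outcome n"
  define p where "p = axis_prob r0 n"
  define q where "q = axis_prob r1 n"
  note defs = x_def y_def w_def p_def q_def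
  have w: "0 < w" "w < 1" unfolding defs using outcome_pos[OF n] outcome_less[OF n] by auto
  have xy: "0 \<le> x" "x \<le> 1" "0 \<le> y" "y \<le> 1" unfolding defs using posterior_bounds[OF n] by auto
  have "x \<noteq> y" unfolding defs using ne posterior_eq_iff[OF n] by auto
  have mult: "w * x = a * p" "w * (1 - x) = b * q" "(1 - w) * y = a * (1 - p)" "(1 - w) * (1 - y) = b * (1 - q)"
    unfolding defs by (rule posterior_mult[OF n])+
  have pr: "r0 \<bullet> n = 2 * p - 1" "r1 \<bullet> n = 2 * q - 1" by (simp_all add: p_def q_def axis_prob_def field_simps)
  have pq: "0 \<le> p" "p \<le> 1" "0 \<le> q" "q \<le> 1" using axis_prob_bounds[OF r0 n] axis_prob_bounds[OF r1 n] by (auto simp: defs)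
  have pb: "(r0 \<bullet> t)\<^sup>2 \<le> 4 * (p * (1 - p))" "(r1 \<bullet> t)\<^sup>2 \<le> 4 * (q * (1 - q))"
  proof -
    have "(norm r0)\<^sup>2 \<le> 1" "(norm r1)\<^sup>2 \<le> 1" using r0 r1 by (simp_all add: power_le_one)
    then show "(r0 \<bullet> t)\<^sup>2 \<le> 4 * (p * (1 - p))" "(r1 \<bullet> t)\<^sup>2 \<le> 4 * (q * (1 - q))"
      using inner_sq_orthonormal_le[OF n t, of r0] inner_sq_orthonormal_le[OF n t, of r1]
      by (simp_all add: pr power2_eq_square algebra_simps)
  qed
  define h1 where "h1 = x * ln x + (1 - x) * ln (1 - x)"
  define h2 where "h2 = y * ln y + (1 - y) * ln (1 - y)"
  \<comment> \<open>Because the slope is 0, \<open>y\<close> in place of \<open>x\<close> would give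
    the same coefficient: the linear function treats both outcomes alike.\<close>
  define \<kappa> where "\<kappa> = a * (r0 \<bullet> t) * ln x + b * (r1 \<bullet> t) * ln (1 - x)"
  define v where "v = (w * h1 - (1 - w) * h2) *\<^sub>R n + \<kappa> *\<^sub>R t"
  have info: "axis_info a b r0 r1 n + a * ln a + b * ln b = w * h1 + (1 - w) * h2"
  proof -
    have "a * (p * ln (x / a)) = a * (p * ln x - p * ln a)"
      using posterior_zero_iff(1)[OF n] a xy ln_shift[of a x p] by (simp add: defs)
    moreover have "a * ((1 - p) * ln (y / a)) = a * ((1 - p) * ln y - (1 - p) * ln a)"
      using posterior_zero_iff(3)[OF n] a xy ln_shift[of a y "1 - p"] by (simp add: defs)
    moreover have "b * (q * ln ((1 - x) / b)) = b * (q * ln (1 - x) - q * ln b)"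
      using posterior_zero_iff(2)[OF n] b xy ln_shift[of b "1 - x" q] by (simp add: defs)
    moreover have "b * ((1 - q) * ln ((1 - y) / b)) = b * ((1 - q) * ln (1 - y) - (1 - q) * ln b)"
      using posterior_zero_iff(4)[OF n] b xy ln_shift[of b "1 - y" "1 - q"] by (simp add: defs)
    ultimately have "axis_info a b r0 r1 n + a * ln a + b * ln b
        = a * p * ln x + b * q * ln (1 - x) + a * (1 - p) * ln y + b * (1 - q) * ln (1 - y)"
      unfolding info_eq_posterior[OF n] defs[symmetric] distrib_left by (simp add: algebra_simps)
    also have "\<dots> = w * h1 + (1 - w) * h2"
      unfolding mult[symmetric] h1_def h2_def by (simp add: algebra_simps)
    finally show ?thesis .
  qed
  have "certifies n v"
    unfolding certifies_def
  proof (intro allI impI)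
    fix \<alpha> s :: real and \<beta> :: "real^3"
    assume \<beta>: "norm \<beta> \<le> \<alpha>" and s: "0 \<le> s" "s \<le> 1"
      and s0: "s = 0 \<longrightarrow> \<alpha> + r0 \<bullet> \<beta> = 0" and s1: "s = 1 \<longrightarrow> \<alpha> + r1 \<bullet> \<beta> = 0"
    \<comment> \<open>In an eigenbasis for \<open>n\<close> the element has the diagonal
      \<open>\<alpha> + \<beta> \<bullet> n\<close>, \<open>\<alpha> - \<beta> \<bullet> n\<close>,
      and the weighted first state the diagonal \<open>w * x\<close>, \<open>(1 - w) * y\<close>. So
      \<open>P * x\<close>, \<open>Q * y\<close> and \<open>2 * D0\<close> are the diagonal and
      off-diagonal parts of its trace against the element; for the second letter
      \<open>1 - x\<close>, \<open>1 - y\<close> and \<open>D1\<close> take their places.\<close>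
    define P where "P = w * (\<alpha> + \<beta> \<bullet> n)"
    define Q where "Q = (1 - w) * (\<alpha> - \<beta> \<bullet> n)"
    define D0 where "D0 = a * (\<beta> \<bullet> t) * (r0 \<bullet> t) / 2"
    define D1 where "D1 = b * (\<beta> \<bullet> t) * (r1 \<bullet> t) / 2"
    have \<beta>n: "\<bar>\<beta> \<bullet> n\<bar> \<le> \<alpha>" using Cauchy_Schwarz_ineq2[of \<beta> n] \<beta> n by simp
    have PQ: "P \<ge> 0" "Q \<ge> 0" using w \<beta>n by (auto simp: P_def Q_def abs_le_iff)
    have \<beta>t: "(\<beta> \<bullet> t)\<^sup>2 \<le> (\<alpha> + \<beta> \<bullet> n) * (\<alpha> - \<beta> \<bullet> n)"
    proof -
      have "(norm \<beta>)\<^sup>2 \<le> \<alpha>\<^sup>2" using \<beta> by (simp add: power_mono)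
      then show ?thesis using inner_sq_orthonormal_le[OF n t, of \<beta>] by (simp add: power2_eq_square algebra_simps)
    qed
    \<comment> \<open>The product of two determinant conditions, positivity of the element and
      positivity of the state.\<close>
    have Dbound: "(c * (\<beta> \<bullet> t) * z / 2)\<^sup>2 \<le> (P * u1) * (Q * u2)"
      if "w * u1 = c * k" "(1 - w) * u2 = c * (1 - k)" "z\<^sup>2 \<le> 4 * (k * (1 - k))" for c z u1 u2 k :: real
    proof -
      have "(\<beta> \<bullet> t)\<^sup>2 * z\<^sup>2 \<le> ((\<alpha> + \<beta> \<bullet> n) * (\<alpha> - \<beta> \<bullet> n)) * (4 * (k * (1 - k)))"
        using \<beta>n by (intro mult_mono \<beta>t that) (auto simp: abs_le_iff)
      then have "c\<^sup>2 * ((\<beta> \<bullet> t)\<^sup>2 * z\<^sup>2) \<le> c\<^sup>2 * (((\<alpha> + \<beta> \<bullet> n) * (\<alpha> - \<beta> \<bullet> n)) * (4 * (k * (1 - k))))"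
        by (intro mult_left_mono) auto
      also have "\<dots> = 4 * ((\<alpha> + \<beta> \<bullet> n) * (\<alpha> - \<beta> \<bullet> n) * ((c * k) * (c * (1 - k))))"
        by (simp add: power2_eq_square)
      also have "\<dots> = 4 * ((P * u1) * (Q * u2))"
        unfolding that(1,2)[symmetric] by (simp add: P_def Q_def)
      finally show ?thesis by (simp add: power_mult_distrib power_divide)
    qed
    have "r \<bullet> \<beta> = (r \<bullet> n) * (\<beta> \<bullet> n) + (r \<bullet> t) * (\<beta> \<bullet> t)"
      if "r = (r \<bullet> n) *\<^sub>R n + (r \<bullet> t) *\<^sub>R t" for r
      using arg_cong[OF that, of "\<lambda>u. u \<bullet> \<beta>"]
      by (simp add: inner_add_left inner_commute[of n \<beta>] inner_commute[of t \<beta>])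
    note \<beta>r = this[OF r0t, unfolded pr] this[OF r1t, unfolded pr]
    have coef0: "P * x + Q * y + 2 * D0 = a * (\<alpha> + r0 \<bullet> \<beta>)"
    proof -
      have "P * x + Q * y = (w * x) * (\<alpha> + \<beta> \<bullet> n) + ((1 - w) * y) * (\<alpha> - \<beta> \<bullet> n)" by (simp add: P_def Q_def)
      then show ?thesis unfolding mult \<beta>r by (simp add: D0_def algebra_simps)
    qed
    have coef1: "P * (1 - x) + Q * (1 - y) + 2 * D1 = b * (\<alpha> + r1 \<bullet> \<beta>)"
    proof -
      have "P * (1 - x) + Q * (1 - y) = (w * (1 - x)) * (\<alpha> + \<beta> \<bullet> n) + ((1 - w) * (1 - y)) * (\<alpha> - \<beta> \<bullet> n)"
        by (simp add: P_def Q_def)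
      then show ?thesis unfolding mult \<beta>r by (simp add: D1_def algebra_simps)
    qed
    define G0 where "G0 = tangent_gap P Q D0 x y s"
    define G1 where "G1 = tangent_gap P Q D1 (1 - x) (1 - y) (1 - s)"
    have G0: "0 \<le> G0 \<and> (G0 = 0 \<longrightarrow> P * (x - s)\<^sup>2 = 0 \<and> Q * (y - s)\<^sup>2 = 0)"
      unfolding G0_def
    proof (rule tangent_gap_nonneg)
      show "D0\<^sup>2 \<le> (P * x) * (Q * y)"
        unfolding D0_def by (rule Dbound[OF mult(1,3) pb(1)])
      show "P * x + Q * y + 2 * D0 = 0" if "s = 0" using s0 that coef0 by simp
    qed (use xy PQ s \<open>x \<noteq> y\<close> in auto)
    have G1: "0 \<le> G1"
      unfolding G1_def
    proof (rule tangent_gap_nonneg[THEN conjunct1])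
      show "D1\<^sup>2 \<le> (P * (1 - x)) * (Q * (1 - y))"
        unfolding D1_def by (rule Dbound[OF mult(2,4) pb(2)])
      show "P * (1 - x) + Q * (1 - y) + 2 * D1 = 0" if "1 - s = 0" using s1 that coef1 by simp
    qed (use xy PQ s \<open>x \<noteq> y\<close> in auto)
    \<comment> \<open>This is where stationarity enters: the difference of the two off-diagonal
      coefficients is a multiple of the slope.\<close>
    have cancel: "D0 * ((ln x - ln y) / (x - y)) - D1 * ((ln (1 - x) - ln (1 - y)) / ((1 - x) - (1 - y))) = 0"
    proof -
      have neg: "(ln (1 - x) - ln (1 - y)) / ((1 - x) - (1 - y)) = - ((ln (1 - x) - ln (1 - y)) / (x - y))"
        using \<open>x \<noteq> y\<close> by (simp add: divide_simps) (simp add: algebra_simps)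
      have "D0 * ((ln x - ln y) / (x - y)) - D1 * ((ln (1 - x) - ln (1 - y)) / ((1 - x) - (1 - y)))
          = (\<beta> \<bullet> t) / 2 * slope n t / (x - y)"
        unfolding neg slope_def D0_def D1_def defs[symmetric]
        using \<open>x \<noteq> y\<close> by (simp add: divide_simps) (simp add: algebra_simps)
      then show ?thesis by (simp add: slope)
    qed
    define L0 where "L0 = (ln x - ln y) / (x - y)"
    define L1 where "L1 = (ln (1 - x) - ln (1 - y)) / ((1 - x) - (1 - y))"
    have "G0 + G1 = P * h1 + Q * h2 + 2 * (s - x) * (D0 * L0 - D1 * L1) + 2 * D0 * ln x + 2 * D1 * ln (1 - x)
        - payoff \<alpha> \<beta> s"
      unfolding G0_def G1_def tangent_gap_def coef0 coef1 L0_def[symmetric] L1_def[symmetric] payoff_def h1_def h2_def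
      by (simp add: algebra_simps)
    also have "D0 * L0 - D1 * L1 = 0" using cancel by (simp add: L0_def L1_def)
    finally have sum: "G0 + G1 = P * h1 + Q * h2 + 2 * D0 * ln x + 2 * D1 * ln (1 - x) - payoff \<alpha> \<beta> s" by simp
    have lin: "(w * h1 + (1 - w) * h2) * \<alpha> + v \<bullet> \<beta> = P * h1 + Q * h2 + 2 * D0 * ln x + 2 * D1 * ln (1 - x)"
      unfolding v_def \<kappa>_def P_def Q_def D0_def D1_def
      by (simp add: inner_add_left inner_commute[of _ \<beta>] algebra_simps)
    show "payoff \<alpha> \<beta> s \<le> (axis_info a b r0 r1 n + a * ln a + b * ln b) * \<alpha> + v \<bullet> \<beta> \<and>
      (payoff \<alpha> \<beta> s = (axis_info a b r0 r1 n + a * ln a + b * ln b) * \<alpha> + v \<bullet> \<beta> \<longrightarrow>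
        (\<alpha> + \<beta> \<bullet> n) * (post_plus n - s) = 0 \<and> (\<alpha> - \<beta> \<bullet> n) * (post_minus n - s) = 0)"
    proof (intro conjI impI)
      show "payoff \<alpha> \<beta> s \<le> (axis_info a b r0 r1 n + a * ln a + b * ln b) * \<alpha> + v \<bullet> \<beta>"
        unfolding info lin using sum G0 G1 by linarith
      assume "payoff \<alpha> \<beta> s = (axis_info a b r0 r1 n + a * ln a + b * ln b) * \<alpha> + v \<bullet> \<beta>"
      then have "G0 = 0" unfolding info lin using sum G0 G1 by linarith
      then have "P * (x - s)\<^sup>2 = 0" "Q * (y - s)\<^sup>2 = 0" using G0 by auto
      then show "(\<alpha> + \<beta> \<bullet> n) * (post_plus n - s) = 0" "(\<alpha> - \<beta> \<bullet> n) * (post_minus n - s) = 0"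
        using w by (auto simp: P_def Q_def defs)
    qed
  qed
  then show ?thesis ..
qed

end

section \<open>The information as a function of the axis\<close>

lemma xlnx_continuous: "continuous_on {0..} (\<lambda>x::real. x * ln x)"
proof (unfold continuous_on_def, intro ballI)
  fix x :: real assume "x \<in> {0..}"
  show "((\<lambda>x. x * ln x) \<longlongrightarrow> x * ln x) (at x within {0..})"
  proof (cases "x = 0")
    case True
    have "((\<lambda>x::real. x * ln x) \<longlongrightarrow> 0) (at_right 0)" by real_asymp
    then show ?thesis by (simp add: True at_within_Ici_at_right)
  next
    case False
    then show ?thesis using \<open>x \<in> {0..}\<close> by (intro tendsto_intros) auto
  qed
qed

lemma bin_entropy_continuous: "continuous_on {0..1} bin_entropy"
proof -
  have "continuous_on {0..1} (\<lambda>u::real. u * ln u)"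
    using xlnx_continuous by (rule continuous_on_subset) auto
  moreover have "continuous_on {0..1} (\<lambda>u::real. (1 - u) * ln (1 - u))"
    by (rule continuous_on_compose2[OF xlnx_continuous]) (auto intro!: continuous_intros)
  ultimately have "continuous_on {0..1} (\<lambda>u::real. - (u * ln u) - (1 - u) * ln (1 - u))"
    by (intro continuous_on_diff continuous_on_minus)
  then show ?thesis by (simp add: bin_entropy_def[abs_def])
qed

lemma norm_convex_comb_le_one:
  fixes r0 r1 :: "'a::real_normed_vector"
  assumes "a > 0" "b > 0" "a + b = 1" "norm r0 \<le> 1" "norm r1 \<le> 1"
  shows "norm (a *\<^sub>R r0 + b *\<^sub>R r1) \<le> 1"
proof -
  have "norm (a *\<^sub>R r0 + b *\<^sub>R r1) \<le> a * norm r0 + b * norm r1"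
    using norm_triangle_ineq[of "a *\<^sub>R r0" "b *\<^sub>R r1"] assms by simp
  also have "\<dots> \<le> a * 1 + b * 1" using assms by (intro add_mono mult_left_mono) auto
  finally show ?thesis using assms by simp
qed

lemma axis_prob_convex_comb:
  "a + b = 1 \<Longrightarrow> axis_prob (a *\<^sub>R r0 + b *\<^sub>R r1) n = a * axis_prob r0 n + b * axis_prob r1 n"
  unfolding axis_prob_def by (simp add: inner_add_left add_divide_distrib algebra_simps)

text \<open>The outcome distribution is that of the average state, so all three entropies have one
  shape, and continuity and differentiability need to be shown for a single state only.\<close>

lemma axis_info_convex_comb:
  "a + b = 1 \<Longrightarrow> axis_info a b r0 r1 n = bin_entropy (axis_prob (a *\<^sub>R r0 + b *\<^sub>R r1) n)
    - a * bin_entropy (axis_prob r0 n) - b * bin_entropy (axis_prob r1 n)"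
  by (simp add: axis_info_def axis_prob_convex_comb)

lemma axis_info_continuous:
  assumes "a > 0" "b > 0" "a + b = 1" "norm r0 \<le> 1" "norm r1 \<le> 1"
  shows "continuous_on (sphere 0 1) (axis_info a b r0 r1)"
proof -
  have "continuous_on (sphere 0 1) (\<lambda>n. bin_entropy (axis_prob r n))" if "norm r \<le> 1" for r
    by (rule continuous_on_compose2[OF bin_entropy_continuous])
      (use axis_prob_bounds[OF that] in \<open>auto simp: axis_prob_def intro!: continuous_intros\<close>)
  note * = this[OF norm_convex_comb_le_one[OF assms]] this[OF assms(4)] this[OF assms(5)]
  have "continuous_on (sphere 0 1) (\<lambda>n. bin_entropy (axis_prob (a *\<^sub>R r0 + b *\<^sub>R r1) n)
    - a * bin_entropy (axis_prob r0 n) - b * bin_entropy (axis_prob r1 n))"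
    by (intro continuous_intros *)
  then show ?thesis using axis_info_convex_comb[OF assms(3)] by (simp add: fun_eq_iff cong: continuous_on_cong)
qed

text \<open>If the probability vanishes at \<open>n\<close>, then \<open>r = - n\<close> and it
  equals \<open>(1 - cos \<theta>) / 2\<close>, of second order in the angle, which beats the
  logarithm. The stated formula persists because then \<open>r \<bullet> t = 0\<close>.\<close>

lemma xlnx_axis_deriv:
  fixes r n t :: "real^3"
  assumes "norm n = 1" "norm r \<le> 1" "t \<bullet> n = 0"
  shows "((\<lambda>\<theta>. axis_prob r (cos \<theta> *\<^sub>R n + sin \<theta> *\<^sub>R t) * ln (axis_prob r (cos \<theta> *\<^sub>R n + sin \<theta> *\<^sub>R t)))
    has_real_derivative (r \<bullet> t) / 2 * (ln (axis_prob r n) + 1)) (at 0)"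
proof (cases "axis_prob r n = 0")
  case True
  then have r: "r = - n" by (intro inner_eq_minus_one assms) (auto simp: axis_prob_def)
  have "n \<bullet> n = 1" using assms by (simp add: dot_square_norm)
  then have prob: "axis_prob r (cos \<theta> *\<^sub>R n + sin \<theta> *\<^sub>R t) = (1 - cos \<theta>) / 2" for \<theta>
    using assms(3) by (simp add: axis_prob_def r inner_add_right inner_commute)
  have "((\<lambda>h::real. (1 - cos h) / 2 * ln ((1 - cos h) / 2) / h) \<longlongrightarrow> 0) (at 0)"
    by real_asymp
  moreover have "r \<bullet> t = 0" using assms(3) by (simp add: r inner_commute)
  ultimately show ?thesis unfolding prob by (simp add: DERIV_def)
next
  case False
  then have pos: "axis_prob r n > 0" using axis_prob_bounds[OF assms(2,1)] by simp
  have "((\<lambda>\<theta>. axis_prob r (cos \<theta> *\<^sub>R n + sin \<theta> *\<^sub>R t)) has_real_derivative (r \<bullet> t) / 2) (at 0)"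
    unfolding axis_prob_def inner_add_right inner_scaleR_right
    by (auto intro!: derivative_eq_intros)
  then show ?thesis
    using pos by (auto intro!: derivative_eq_intros simp: algebra_simps)
qed

lemma bin_entropy_axis_deriv:
  fixes r n t :: "real^3"
  assumes "norm n = 1" "norm r \<le> 1" "t \<bullet> n = 0"
  shows "((\<lambda>\<theta>. bin_entropy (axis_prob r (cos \<theta> *\<^sub>R n + sin \<theta> *\<^sub>R t)))
    has_real_derivative - (r \<bullet> t) / 2 * (ln (axis_prob r n) - ln (1 - axis_prob r n))) (at 0)"
proof -
  have compl: "axis_prob (- r) m = 1 - axis_prob r m" for m by (simp add: axis_prob_def field_simps)
  have "((\<lambda>\<theta>. - (axis_prob r (cos \<theta> *\<^sub>R n + sin \<theta> *\<^sub>R t) * ln (axis_prob r (cos \<theta> *\<^sub>R n + sin \<theta> *\<^sub>R t)))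
      - axis_prob (- r) (cos \<theta> *\<^sub>R n + sin \<theta> *\<^sub>R t) * ln (axis_prob (- r) (cos \<theta> *\<^sub>R n + sin \<theta> *\<^sub>R t)))
    has_real_derivative - ((r \<bullet> t) / 2 * (ln (axis_prob r n) + 1)) - (- r \<bullet> t) / 2 * (ln (axis_prob (- r) n) + 1)) (at 0)"
    by (intro DERIV_diff DERIV_minus xlnx_axis_deriv) (use assms in auto)
  then show ?thesis
    unfolding compl bin_entropy_def by (simp add: algebra_simps diff_divide_distrib add_divide_distrib)
qed

section \<open>Orthonormal frames and the unit circle of a plane\<close>

lemma plane_orthogonal_unit:
  fixes W :: "'a::euclidean_space set"
  assumes "subspace W" "dim W = 2" "n \<in> W" "norm n = 1"
  obtains t where "t \<in> W" "norm t = 1" "t \<bullet> n = 0"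
proof -
  have "\<not> W \<subseteq> span {n}"
  proof
    assume "W \<subseteq> span {n}"
    then have "dim W \<le> card {n}" by (intro dim_le_card) auto
    then show False using assms by simp
  qed
  then obtain z where z: "z \<in> W" "z \<notin> span {n}" by blast
  define u where "u = z - (z \<bullet> n) *\<^sub>R n"
  have "u \<in> W" unfolding u_def using assms z by (intro subspace_diff subspace_scale)
  moreover have "u \<noteq> 0"
  proof
    assume "u = 0"
    then have "z = (z \<bullet> n) *\<^sub>R n" by (simp add: u_def)
    then show False using z(2) by (metis insertI1 span_base span_scale)
  qed
  moreover have "u \<bullet> n = 0" using assms by (simp add: u_def inner_diff_left dot_square_norm)
  ultimately show thesis
    using assms(1) by (intro that[of "(1 / norm u) *\<^sub>R u"]) (auto intro: subspace_scale)
qed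

text \<open>A nonzero remainder would be orthogonal to \<open>n\<close> and \<open>t\<close> and
  give three independent vectors in \<open>W\<close>.\<close>

lemma plane_decomp:
  fixes W :: "'a::euclidean_space set"
  assumes "subspace W" "dim W = 2" "n \<in> W" "norm n = 1" "t \<in> W" "norm t = 1" "t \<bullet> n = 0" "u \<in> W"
  shows "u = (u \<bullet> n) *\<^sub>R n + (u \<bullet> t) *\<^sub>R t"
proof (rule ccontr)
  define z where "z = u - (u \<bullet> n) *\<^sub>R n - (u \<bullet> t) *\<^sub>R t"
  assume "\<not> ?thesis"
  then have "z \<noteq> 0" by (auto simp: z_def algebra_simps)
  have sq: "n \<bullet> n = 1" "t \<bullet> t = 1" "n \<bullet> t = 0" using assms by (simp_all add: dot_square_norm inner_commute)
  have orth: "z \<bullet> n = 0" "z \<bullet> t = 0" using assms(7) sq by (simp_all add: z_def inner_diff_left)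
  have "z \<in> W" unfolding z_def using assms by (intro subspace_diff subspace_scale)
  have "z \<noteq> n" "z \<noteq> t" "n \<noteq> t" using orth sq \<open>z \<noteq> 0\<close> by auto
  have "independent {n, t, z}"
  proof (rule pairwise_orthogonal_independent)
    show "pairwise orthogonal {n, t, z}"
      using orth sq by (auto simp: pairwise_def orthogonal_def inner_commute)
    show "0 \<notin> {n, t, z}" using sq \<open>z \<noteq> 0\<close> by auto
  qed
  then have "card {n, t, z} \<le> dim W"
    using assms \<open>z \<in> W\<close> by (intro independent_card_le_dim) auto
  then show False using assms \<open>z \<noteq> n\<close> \<open>z \<noteq> t\<close> \<open>n \<noteq> t\<close> by simp
qed

lemma circle_point:
  fixes n t :: "'a::real_inner"
  assumes "subspace W" "n \<in> W" "norm n = 1" "t \<in> W" "norm t = 1" "t \<bullet> n = 0"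
  shows "cos \<theta> *\<^sub>R n + sin \<theta> *\<^sub>R t \<in> W \<inter> sphere 0 1"
proof -
  have "(norm (cos \<theta> *\<^sub>R n + sin \<theta> *\<^sub>R t))\<^sup>2 = (cos \<theta>)\<^sup>2 * (n \<bullet> n) + (sin \<theta>)\<^sup>2 * (t \<bullet> t) + 2 * cos \<theta> * sin \<theta> * (t \<bullet> n)"
    by (simp add: power2_norm_eq_inner inner_add_left inner_add_right inner_commute)
       (simp add: power2_eq_square)
  also have "\<dots> = 1" using assms by (simp add: dot_square_norm)
  finally have "norm (cos \<theta> *\<^sub>R n + sin \<theta> *\<^sub>R t) = 1"
    by (metis norm_ge_zero power2_eq_1_iff neg_0_le_iff_le not_one_le_zero)
  moreover have "cos \<theta> *\<^sub>R n + sin \<theta> *\<^sub>R t \<in> W"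
    using assms by (intro subspace_add subspace_scale)
  ultimately show ?thesis by simp
qed

lemma axis_of_eq_iff: "axis_of n = axis_of m \<longleftrightarrow> n = m \<or> n = - m"
  by (auto simp: axis_of_def doubleton_eq_iff)

section \<open>Angular derivative and zeros of the information\<close>

context qubit_ensemble
begin

text \<open>The three entropy derivatives regroup by Bayes' rule: the log-odds of a likelihood minus
  those of the outcome equal a difference of log-posteriors. Where a likelihood is 0 or 1 the state
  is transverse to \<open>t\<close> and both sides vanish.\<close>

lemma axis_info_deriv:
  assumes n: "norm n = 1" and t: "t \<bullet> n = 0"
  shows "((\<lambda>\<theta>. axis_info a b r0 r1 (cos \<theta> *\<^sub>R n + sin \<theta> *\<^sub>R t)) has_real_derivative slope n t / 2) (at 0)"
proof -
  let ?r = "a *\<^sub>R r0 + b *\<^sub>R r1"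
  have "((\<lambda>\<theta>. axis_info a b r0 r1 (cos \<theta> *\<^sub>R n + sin \<theta> *\<^sub>R t)) has_real_derivative
     - (?r \<bullet> t) / 2 * (ln (axis_prob ?r n) - ln (1 - axis_prob ?r n))
     - a * (- (r0 \<bullet> t) / 2 * (ln (axis_prob r0 n) - ln (1 - axis_prob r0 n)))
     - b * (- (r1 \<bullet> t) / 2 * (ln (axis_prob r1 n) - ln (1 - axis_prob r1 n)))) (at 0)"
    unfolding axis_info_convex_comb[OF ab]
    by (intro DERIV_diff DERIV_cmult bin_entropy_axis_deriv n t r0 r1 norm_convex_comb_le_one a b ab)
  also have "axis_prob ?r n = outcome n" by (simp add: axis_prob_convex_comb[OF ab] outcome_def)
  also have "- (?r \<bullet> t) / 2 * (ln (outcome n) - ln (1 - outcome n))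
     - a * (- (r0 \<bullet> t) / 2 * (ln (axis_prob r0 n) - ln (1 - axis_prob r0 n)))
     - b * (- (r1 \<bullet> t) / 2 * (ln (axis_prob r1 n) - ln (1 - axis_prob r1 n))) = slope n t / 2"
  proof -
    have edge: "r \<bullet> t = 0" if "norm r \<le> 1" "axis_prob r n = 0 \<or> axis_prob r n = 1" for r
      using axis_prob_zero[OF that(1) n] axis_prob_one[OF that(1) n] that(2) t by (auto simp: inner_commute)
    have e0: "(r0 \<bullet> t) * (ln (post_plus n) - ln (post_minus n))
      = (r0 \<bullet> t) * ((ln (axis_prob r0 n) - ln (1 - axis_prob r0 n)) - (ln (outcome n) - ln (1 - outcome n)))"
    proof (cases "axis_prob r0 n = 0 \<or> axis_prob r0 n = 1")
      case False
      then have "0 < axis_prob r0 n" "axis_prob r0 n < 1" using axis_prob_bounds[OF r0 n] by auto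
      then show ?thesis
        using outcome_pos[OF n] outcome_less[OF n] a by (simp add: post_plus_def post_minus_def ln_div ln_mult)
    qed (use edge[OF r0] in auto)
    have e1: "(r1 \<bullet> t) * (ln (1 - post_plus n) - ln (1 - post_minus n))
      = (r1 \<bullet> t) * ((ln (axis_prob r1 n) - ln (1 - axis_prob r1 n)) - (ln (outcome n) - ln (1 - outcome n)))"
    proof (cases "axis_prob r1 n = 0 \<or> axis_prob r1 n = 1")
      case False
      then have "0 < axis_prob r1 n" "axis_prob r1 n < 1" using axis_prob_bounds[OF r1 n] by auto
      moreover have "1 - post_plus n = b * axis_prob r1 n / outcome n"
        "1 - post_minus n = b * (1 - axis_prob r1 n) / (1 - outcome n)"
        using posterior_mult[OF n] outcome_pos[OF n] outcome_less[OF n] by (simp_all add: field_simps)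
      ultimately show ?thesis
        using outcome_pos[OF n] outcome_less[OF n] b by (simp add: ln_div ln_mult)
    qed (use edge[OF r1] in auto)
    show ?thesis
      unfolding slope_def mult.assoc e0 e1 by (simp add: inner_add_left) (simp add: algebra_simps add_divide_distrib diff_divide_distrib)
  qed
  finally show ?thesis .
qed

text \<open>Gibbs' inequality term by term. The subtracted linear parts such as \<open>p - w\<close>
  sum to 0 with the weights \<open>a\<close> and \<open>b\<close>, so the information is a sum of
  nonnegative terms, each with its own equality case.\<close>

lemma axis_info_nonneg:
  assumes n: "norm n = 1"
  shows "0 \<le> axis_info a b r0 r1 n" and "axis_info a b r0 r1 n = 0 \<longleftrightarrow> (r0 - r1) \<bullet> n = 0"
proof -
  have gap: "p - w \<le> p * ln (p / w) \<and> (p * ln (p / w) = p - w \<longrightarrow> p = w)"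
    if "0 \<le> p" "0 < w" for p w :: real
  proof (cases "p = 0")
    case False
    then show ?thesis using that log_tangent[of w p] by (auto simp: ln_div algebra_simps)
  qed (use that in auto)
  define p where "p = axis_prob r0 n"
  define q where "q = axis_prob r1 n"
  define w where "w = outcome n"
  have pq: "0 \<le> p" "p \<le> 1" "0 \<le> q" "q \<le> 1"
    using axis_prob_bounds[OF r0 n] axis_prob_bounds[OF r1 n] by (auto simp: p_def q_def)
  have w: "0 < w" "w < 1" "w = a * p + b * q" using outcome_pos[OF n] outcome_less[OF n] by (auto simp: w_def outcome_def p_def q_def)
  have w': "1 - w = a * (1 - p) + b * (1 - q)" using ab w(3) by (simp add: algebra_simps)
  let ?S = "a * (p * ln (p / w) - (p - w)) + b * (q * ln (q / w) - (q - w))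
    + a * ((1 - p) * ln ((1 - p) / (1 - w)) - ((1 - p) - (1 - w))) + b * ((1 - q) * ln ((1 - q) / (1 - w)) - ((1 - q) - (1 - w)))"
  have S: "axis_info a b r0 r1 n = ?S"
    unfolding axis_info_eq[OF a b ab r0 r1 n] info_term_def p_def[symmetric] q_def[symmetric] w(3)[symmetric] w'[symmetric]
    by (simp add: algebra_simps)
  have parts: "0 \<le> a * (p * ln (p / w) - (p - w))" "0 \<le> b * (q * ln (q / w) - (q - w))"
    "0 \<le> a * ((1 - p) * ln ((1 - p) / (1 - w)) - ((1 - p) - (1 - w)))"
    "0 \<le> b * ((1 - q) * ln ((1 - q) / (1 - w)) - ((1 - q) - (1 - w)))"
    using gap[of p w] gap[of q w] gap[of "1 - p" "1 - w"] gap[of "1 - q" "1 - w"] pq w a b by simp_all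
  show "0 \<le> axis_info a b r0 r1 n" unfolding S using parts by linarith
  have iff: "(r0 - r1) \<bullet> n = 0 \<longleftrightarrow> p = q" by (auto simp: p_def q_def axis_prob_def inner_diff_left)
  show "axis_info a b r0 r1 n = 0 \<longleftrightarrow> (r0 - r1) \<bullet> n = 0"
  proof
    assume "axis_info a b r0 r1 n = 0"
    then have "a * (p * ln (p / w) - (p - w)) = 0" "b * (q * ln (q / w) - (q - w)) = 0"
      unfolding S using parts by linarith+
    then show "(r0 - r1) \<bullet> n = 0" unfolding iff using gap[of p w] gap[of q w] pq w a b by auto
  next
    assume "(r0 - r1) \<bullet> n = 0"
    then have "p = q" by (simp add: iff)
    then have "w = p" using w(3) ab by (metis distrib_right mult_1)
    then show "axis_info a b r0 r1 n = 0"
      using \<open>p = q\<close> w by (simp add: S)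
  qed
qed

text \<open>Stationarity off the null axis, freed from the plane: a tangent is asked for that spans
  both Bloch vectors together with \<open>n\<close>. The consequences then hold over all effects and
  the whole sphere.\<close>

definition critical :: "real^3 \<Rightarrow> bool" where
  "critical n \<longleftrightarrow> norm n = 1 \<and> (r0 - r1) \<bullet> n \<noteq> 0 \<and>
    (\<exists>t. norm t = 1 \<and> t \<bullet> n = 0 \<and> r0 = (r0 \<bullet> n) *\<^sub>R n + (r0 \<bullet> t) *\<^sub>R t \<and>
         r1 = (r1 \<bullet> n) *\<^sub>R n + (r1 \<bullet> t) *\<^sub>R t \<and> slope n t = 0)"

lemma critical_certificate: "critical n \<Longrightarrow> \<exists>v. certifies n v"
  unfolding critical_def using certificate by blast

text \<open>The two spectral projections of \<open>R\<close> have Bloch data \<open>1/2\<close> and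
  \<open>m\<close> times \<open>1/2\<close> or \<open>- 1/2\<close>, and the eigenvalues of
  \<open>R\<close> act as announced posteriors. Adding the two certificates cancels the vector
  part.\<close>

lemma critical_maximizes_posterior_fun:
  assumes n: "critical n" and R: "effect R"
  shows "posterior_fun a b (bloch_state r0) (bloch_state r1) R \<le> ereal (axis_info a b r0 r1 n) \<and>
    (posterior_fun a b (bloch_state r0) (bloch_state r1) R = ereal (axis_info a b r0 r1 n) \<longrightarrow>
      R = spec n (post_plus n) (post_minus n))"
proof -
  obtain m s1 s2 where m: "norm m = 1" and s: "0 \<le> s1" "s1 \<le> 1" "0 \<le> s2" "s2 \<le> 1" and R: "R = spec m s1 s2"
    using R by (rule effectE)
  let ?dom = "(s1 = 0 \<longrightarrow> 1 + r0 \<bullet> m = 0) \<and> (s2 = 0 \<longrightarrow> 1 - r0 \<bullet> m = 0) \<and>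
        (s1 = 1 \<longrightarrow> 1 + r1 \<bullet> m = 0) \<and> (s2 = 1 \<longrightarrow> 1 - r1 \<bullet> m = 0)"
  show ?thesis
  proof (cases ?dom)
    case False
    then show ?thesis unfolding R posterior_fun_spec[OF m r0 r1] if_not_P[OF False] by simp
  next
    case dom: True
    obtain v where v: "certifies n v"
      using critical_certificate[OF n] by blast
    define l where "l = axis_info a b r0 r1 n + a * ln a + b * ln b"
    have v1: "payoff (1/2) ((1/2) *\<^sub>R m) s1 \<le> l * (1/2) + v \<bullet> ((1/2) *\<^sub>R m) \<and>
      (payoff (1/2) ((1/2) *\<^sub>R m) s1 = l * (1/2) + v \<bullet> ((1/2) *\<^sub>R m) \<longrightarrow>
        (1/2 + ((1/2) *\<^sub>R m) \<bullet> n) * (post_plus n - s1) = 0 \<and> (1/2 - ((1/2) *\<^sub>R m) \<bullet> n) * (post_minus n - s1) = 0)"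
      unfolding l_def by (rule certifiesD[OF v]) (use m s dom in \<open>auto simp flip: add_divide_distrib\<close>)
    have v2: "payoff (1/2) (- (1/2) *\<^sub>R m) s2 \<le> l * (1/2) + v \<bullet> (- (1/2) *\<^sub>R m) \<and>
      (payoff (1/2) (- (1/2) *\<^sub>R m) s2 = l * (1/2) + v \<bullet> (- (1/2) *\<^sub>R m) \<longrightarrow>
        (1/2 + (- (1/2) *\<^sub>R m) \<bullet> n) * (post_plus n - s2) = 0 \<and> (1/2 - (- (1/2) *\<^sub>R m) \<bullet> n) * (post_minus n - s2) = 0)"
      unfolding l_def by (rule certifiesD[OF v]) (use m s dom in \<open>auto simp flip: diff_divide_distrib\<close>)
    have neg: "v \<bullet> (- (1/2) *\<^sub>R m) = - (v \<bullet> ((1/2) *\<^sub>R m))" by simp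
    have le: "payoff (1/2) ((1/2) *\<^sub>R m) s1 + payoff (1/2) (- (1/2) *\<^sub>R m) s2 \<le> l"
      using v1[THEN conjunct1] v2[THEN conjunct1] neg by linarith
    have val: "posterior_fun a b (bloch_state r0) (bloch_state r1) R =
      ereal (payoff (1/2) ((1/2) *\<^sub>R m) s1 + payoff (1/2) (- (1/2) *\<^sub>R m) s2 - a * ln a - b * ln b)"
    proof -
      have 1: "ln (s1 / a) * ((1 + r0 \<bullet> m) / 2) = (1 + r0 \<bullet> m) / 2 * ln s1 - (1 + r0 \<bullet> m) / 2 * ln a"
        using ln_shift[of a s1 "(1 + r0 \<bullet> m) / 2"] a s dom by (simp add: mult.commute)
      have 2: "ln (s2 / a) * ((1 - r0 \<bullet> m) / 2) = (1 - r0 \<bullet> m) / 2 * ln s2 - (1 - r0 \<bullet> m) / 2 * ln a"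
        using ln_shift[of a s2 "(1 - r0 \<bullet> m) / 2"] a s dom by (simp add: mult.commute)
      have 3: "ln ((1 - s1) / b) * ((1 + r1 \<bullet> m) / 2) = (1 + r1 \<bullet> m) / 2 * ln (1 - s1) - (1 + r1 \<bullet> m) / 2 * ln b"
        using ln_shift[of b "1 - s1" "(1 + r1 \<bullet> m) / 2"] b s dom by (simp add: mult.commute)
      have 4: "ln ((1 - s2) / b) * ((1 - r1 \<bullet> m) / 2) = (1 - r1 \<bullet> m) / 2 * ln (1 - s2) - (1 - r1 \<bullet> m) / 2 * ln b"
        using ln_shift[of b "1 - s2" "(1 - r1 \<bullet> m) / 2"] b s dom by (simp add: mult.commute)
      show ?thesis
        unfolding R posterior_fun_spec[OF m r0 r1] if_P[OF dom] 1 2 3 4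
        by (simp add: payoff_def field_simps)
    qed
    have eqR: "R = spec n (post_plus n) (post_minus n)"
      if eq: "payoff (1/2) ((1/2) *\<^sub>R m) s1 + payoff (1/2) (- (1/2) *\<^sub>R m) s2 = l"
    proof -
      have "payoff (1/2) ((1/2) *\<^sub>R m) s1 = l * (1/2) + v \<bullet> ((1/2) *\<^sub>R m)"
        "payoff (1/2) (- (1/2) *\<^sub>R m) s2 = l * (1/2) + v \<bullet> (- (1/2) *\<^sub>R m)"
        using eq v1[THEN conjunct1] v2[THEN conjunct1] neg by linarith+
      then have *: "(1 + m \<bullet> n) * (post_plus n - s1) = 0" "(1 - m \<bullet> n) * (post_minus n - s1) = 0"
        "(1 - m \<bullet> n) * (post_plus n - s2) = 0" "(1 + m \<bullet> n) * (post_minus n - s2) = 0"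
        using v1 v2 by (auto simp: field_simps)
      have norm_n: "norm n = 1" and "post_plus n \<noteq> post_minus n"
        using n posterior_eq_iff by (auto simp: critical_def)
      \<comment> \<open>If both factors were nonzero, \<open>s1\<close> would equal both posteriors
        at \<open>n\<close>.\<close>
      then consider "1 + m \<bullet> n = 0" | "1 - m \<bullet> n = 0" using *(1,2) by force
      then show ?thesis
      proof cases
        case 1
        then have "m = - n" using inner_eq_minus_one[OF norm_n] m by simp
        then show ?thesis using * norm_n by (simp add: R spec_uminus dot_square_norm)
      next
        case 2
        then have "m = n" using inner_eq_minus_one[of n "- m"] m norm_n by simp
        then show ?thesis using * norm_n by (simp add: R dot_square_norm)
      qed
    qed
    show ?thesis unfolding val using le by (auto simp: l_def intro!: eqR)
  qed
qed

lemma critical_acc_info: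
  assumes n: "critical n"
  shows "acc_info a b (bloch_state r0) (bloch_state r1) = ereal (axis_info a b r0 r1 n)"
proof (rule antisym)
  have norm_n: "norm n = 1" using n by (simp add: critical_def)
  obtain v where v: "certifies n v"
    using critical_certificate[OF n] by blast
  \<comment> \<open>The prior terms omitted in \<open>payoff\<close> are linear in the element:
    their scalar part cancels the added constant, their vector part is absorbed here.\<close>
  let ?v = "v - (a * ln a) *\<^sub>R r0 - (b * ln b) *\<^sub>R r1"
  have "info_term a b (\<alpha> + r0 \<bullet> \<beta>) (\<alpha> + r1 \<bullet> \<beta>) \<le> axis_info a b r0 r1 n * \<alpha> + ?v \<bullet> \<beta>"
    if \<beta>: "norm \<beta> \<le> \<alpha>" for \<alpha> \<beta>
  proof -
    have nonneg: "0 \<le> \<alpha> + r \<bullet> \<beta>" if "norm r \<le> 1" for r :: "real^3"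
    proof -
      have "\<bar>r \<bullet> \<beta>\<bar> \<le> norm r * norm \<beta>" by (rule Cauchy_Schwarz_ineq2)
      also have "\<dots> \<le> 1 * \<alpha>" using \<beta> that by (intro mult_mono) auto
      finally show ?thesis by (simp add: abs_le_iff)
    qed
    define p where "p = \<alpha> + r0 \<bullet> \<beta>"
    define q where "q = \<alpha> + r1 \<bullet> \<beta>"
    define w where "w = a * p + b * q"
    \<comment> \<open>The true posterior of the element. On an element that never fires any interior
      value will do; \<open>1/2\<close> stays clear of the conditions at 0 and 1.\<close>
    define s where "s = (if w = 0 then 1/2 else a * p / w)"
    have pq: "0 \<le> p" "0 \<le> q" using nonneg r0 r1 by (auto simp: p_def q_def)
    then have ap: "0 \<le> a * p" "0 \<le> b * q" using a b by simp_all
    have w0: "p = 0 \<and> q = 0" if "w = 0" using that ap a b by (auto simp: w_def add_nonneg_eq_0_iff)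
    have ws: "w * s = a * p" by (cases "w = 0") (simp_all add: s_def w0)
    then have ws': "w * (1 - s) = b * q" unfolding right_diff_distrib by (simp add: w_def)
    have "0 \<le> s \<and> s \<le> 1"
    proof (cases "w = 0")
      case False
      then have "w > 0" using ap by (simp add: w_def)
      then show ?thesis using ap ws ws' by (metis diff_ge_0_iff_ge zero_le_mult_iff not_less)
    qed (simp add: s_def)
    then have s: "0 \<le> s" "s \<le> 1" "w * s = a * p" "w * (1 - s) = b * q" using ws ws' by auto
    have "s = 0 \<Longrightarrow> p = 0" "s = 1 \<Longrightarrow> q = 0" using s(3,4) a b by auto
    then have bound: "payoff \<alpha> \<beta> s \<le> (axis_info a b r0 r1 n + a * ln a + b * ln b) * \<alpha> + v \<bullet> \<beta>"
      using certifiesD[OF v \<beta> s(1,2)] by (auto simp: p_def q_def)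
    have "p * ln (s / a) = p * ln s - p * ln a"
      using ln_shift[of a s p] a s \<open>s = 0 \<Longrightarrow> p = 0\<close> by blast
    moreover have "q * ln ((1 - s) / b) = q * ln (1 - s) - q * ln b"
      using ln_shift[of b "1 - s" q] b s \<open>s = 1 \<Longrightarrow> q = 0\<close> by force
    moreover have "p * ln (p / w) = p * ln (s / a)" "q * ln (q / w) = q * ln ((1 - s) / b)"
    proof -
      have "s / a = p / w \<and> (1 - s) / b = q / w" if "w \<noteq> 0"
        using s(3,4) a b that by (simp add: field_simps)
      then show "p * ln (p / w) = p * ln (s / a)" "q * ln (q / w) = q * ln ((1 - s) / b)"
        using w0 by (cases "w = 0"; simp)+
    qed
    ultimately have "info_term a b p q = a * (p * ln s - p * ln a) + b * (q * ln (1 - s) - q * ln b)"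
      unfolding info_term_def w_def[symmetric] by (simp only: mult.assoc)
    also have "\<dots> = payoff \<alpha> \<beta> s - a * ln a * p - b * ln b * q"
      unfolding payoff_def p_def[symmetric] q_def[symmetric] by (simp add: algebra_simps)
    also have "\<dots> \<le> axis_info a b r0 r1 n * \<alpha> + ?v \<bullet> \<beta>"
      using bound by (simp add: p_def q_def inner_diff_left algebra_simps)
    finally show ?thesis by (simp add: p_def q_def)
  qed
  then have "povm_info a b (bloch_state r0) (bloch_state r1) M \<le> axis_info a b r0 r1 n" if "povm M" for M
    using povm_info_le[OF a b that] by blast
  then show "acc_info a b (bloch_state r0) (bloch_state r1) \<le> ereal (axis_info a b r0 r1 n)"
    unfolding acc_info_def by (intro SUP_least) auto
  show "ereal (axis_info a b r0 r1 n) \<le> acc_info a b (bloch_state r0) (bloch_state r1)"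
    unfolding acc_info_def povm_info_pvm[OF a b ab r0 r1 norm_n, symmetric]
    by (rule SUP_upper) (simp add: povm_pvm norm_n)
qed

lemma critical_unique_arg_max:
  assumes n: "critical n"
  shows "is_arg_max (posterior_fun a b (bloch_state r0) (bloch_state r1)) effect R \<longleftrightarrow>
    R = spec n (post_plus n) (post_minus n)"
proof -
  have norm_n: "norm n = 1" using n by (simp add: critical_def)
  note max = critical_maximizes_posterior_fun[OF n] and attained = posterior_fun_axis[OF norm_n] effect_axis[OF norm_n]
  show ?thesis
  proof
    assume *: "is_arg_max (posterior_fun a b (bloch_state r0) (bloch_state r1)) effect R"
    then have "effect R" by (simp add: is_arg_max_def)
    moreover have "\<not> posterior_fun a b (bloch_state r0) (bloch_state r1) R < ereal (axis_info a b r0 r1 n)"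
      using * attained unfolding is_arg_max_def by metis
    ultimately show "R = spec n (post_plus n) (post_minus n)" using max by force
  next
    assume "R = spec n (post_plus n) (post_minus n)"
    then show "is_arg_max (posterior_fun a b (bloch_state r0) (bloch_state r1)) effect R"
      using attained max unfolding is_arg_max_def by (metis leD)
  qed
qed

lemma critical_R_star:
  assumes n: "critical n"
  shows "R_star a b (bloch_state r0) (bloch_state r1) = spec n (post_plus n) (post_minus n)"
  unfolding R_star_def arg_max_def critical_unique_arg_max[OF n] by simp

lemma critical_info_max:
  assumes n: "critical n" and m: "norm m = 1"
  shows "axis_info a b r0 r1 m \<le> axis_info a b r0 r1 n"
    and "axis_info a b r0 r1 m = axis_info a b r0 r1 n \<Longrightarrow> m = n \<or> m = - n"
proof -
  let ?R = "spec m (post_plus m) (post_minus m)"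
  have norm_n: "norm n = 1" and ne: "post_plus n \<noteq> post_minus n"
    using n posterior_eq_iff by (auto simp: critical_def)
  note max = critical_maximizes_posterior_fun[OF n effect_axis[OF m], unfolded posterior_fun_axis[OF m]]
  show "axis_info a b r0 r1 m \<le> axis_info a b r0 r1 n" using max by simp
  assume "axis_info a b r0 r1 m = axis_info a b r0 r1 n"
  then have eq: "?R = spec n (post_plus n) (post_minus n)" using max by simp
  \<comment> \<open>The operator determines the axis only if its eigenvalues differ; equal ones
    would mean information 0, while that at \<open>n\<close> is nonzero.\<close>
  have ne_m: "post_plus m \<noteq> post_minus m"
  proof
    assume "post_plus m = post_minus m"
    then have "axis_info a b r0 r1 n = 0"
      using axis_info_nonneg(2)[OF m] posterior_eq_iff[OF m] \<open>axis_info a b r0 r1 m = axis_info a b r0 r1 n\<close> by simp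
    then show False using axis_info_nonneg(2)[OF norm_n] n by (simp add: critical_def)
  qed
  have "pvm m = pvm n"
    using spectral_projections_spec[OF m ne_m] spectral_projections_spec[OF norm_n ne] eq by simp
  moreover have "pvm k = {bloch_state k, bloch_state (- k)}" for k
    by (simp add: pvm_def bloch_state_def pauli_uminus)
  ultimately show "m = n \<or> m = - n" by (auto simp: doubleton_eq_iff)
qed

end

section \<open>Stationary axes on the circle of a plane\<close>

locale qubit_ensemble_plane = qubit_ensemble +
  fixes W :: "(real^3) set"
  assumes W: "subspace W" "dim W = 2" and r0W: "r0 \<in> W" and r1W: "r1 \<in> W"
begin

lemma tangentE:
  assumes "n \<in> W \<inter> sphere 0 1"
  obtains t where "t \<in> W" "norm t = 1" "t \<bullet> n = 0"
  using plane_orthogonal_unit[OF W, of n] assms by auto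

lemma stationary_iff_slope:
  assumes "n \<in> W \<inter> sphere 0 1"
  shows "stationary a b r0 r1 W n \<longleftrightarrow> (\<exists>t\<in>W. norm t = 1 \<and> t \<bullet> n = 0 \<and> slope n t = 0)"
proof -
  have "norm n = 1" using assms by simp
  then have "((\<lambda>\<theta>. axis_info a b r0 r1 (cos \<theta> *\<^sub>R n + sin \<theta> *\<^sub>R t)) has_real_derivative 0) (at 0)
      \<longleftrightarrow> slope n t = 0" if "t \<bullet> n = 0" for t
    using axis_info_deriv[OF _ that] DERIV_unique by fastforce
  then show ?thesis unfolding stationary_def by blast
qed

lemma stationary_critical:
  assumes n: "n \<in> W \<inter> sphere 0 1" and "stationary a b r0 r1 W n" and ne: "(r0 - r1) \<bullet> n \<noteq> 0"
  shows "critical n"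
proof -
  obtain t where t: "t \<in> W" "norm t = 1" "t \<bullet> n = 0" "slope n t = 0"
    using assms stationary_iff_slope by blast
  have "r = (r \<bullet> n) *\<^sub>R n + (r \<bullet> t) *\<^sub>R t" if "r \<in> W" for r
    using plane_decomp[OF W _ _ t(1-3) that] n by auto
  with r0W r1W t n ne show ?thesis unfolding critical_def by (auto 4 3)
qed

lemma extremum_stationary:
  assumes n: "n \<in> W \<inter> sphere 0 1"
    and ext: "(\<forall>m \<in> W \<inter> sphere 0 1. axis_info a b r0 r1 m \<le> axis_info a b r0 r1 n) \<or>
      (\<forall>m \<in> W \<inter> sphere 0 1. axis_info a b r0 r1 n \<le> axis_info a b r0 r1 m)"
  shows "stationary a b r0 r1 W n"
proof -
  obtain t where t: "t \<in> W" "norm t = 1" "t \<bullet> n = 0" using n by (rule tangentE)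
  let ?f = "\<lambda>\<theta>. axis_info a b r0 r1 (cos \<theta> *\<^sub>R n + sin \<theta> *\<^sub>R t)"
  have circle: "cos \<theta> *\<^sub>R n + sin \<theta> *\<^sub>R t \<in> W \<inter> sphere 0 1" for \<theta>
    using circle_point[OF W(1) _ _ t] n by auto
  have deriv: "(?f has_real_derivative slope n t / 2) (at 0)"
    using n t by (intro axis_info_deriv) auto
  have "slope n t / 2 = 0"
    using ext
  proof
    assume "\<forall>m \<in> W \<inter> sphere 0 1. axis_info a b r0 r1 m \<le> axis_info a b r0 r1 n"
    then have "\<forall>y. \<bar>0 - y\<bar> < 1 \<longrightarrow> ?f y \<le> ?f 0" using circle by simp
    then show ?thesis by (rule DERIV_local_max[OF deriv zero_less_one])
  next
    assume "\<forall>m \<in> W \<inter> sphere 0 1. axis_info a b r0 r1 n \<le> axis_info a b r0 r1 m"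
    then have "\<forall>y. \<bar>0 - y\<bar> < 1 \<longrightarrow> ?f 0 \<le> ?f y" using circle by simp
    then show ?thesis by (rule DERIV_local_min[OF deriv zero_less_one])
  qed
  then show ?thesis using stationary_iff_slope[OF n] t by auto
qed

text \<open>A maximum of the information on the compact circle is stationary. It is not the null
  axis, since the direction of \<open>r0 - r1\<close> already has positive information.\<close>

lemma max_axis:
  obtains n where "n \<in> W \<inter> sphere 0 1" "critical n"
proof -
  let ?d = "(1 / norm (r0 - r1)) *\<^sub>R (r0 - r1)"
  have d: "?d \<in> W \<inter> sphere 0 1" "(r0 - r1) \<bullet> ?d \<noteq> 0"
    using distinct W(1) r0W r1W by (auto intro: subspace_scale subspace_diff)
  have "compact (W \<inter> sphere 0 1)" using W(1) by (intro closed_Int_compact closed_subspace) auto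
  moreover have "continuous_on (W \<inter> sphere 0 1) (axis_info a b r0 r1)"
    using axis_info_continuous[OF a b ab r0 r1] by (rule continuous_on_subset) auto
  ultimately obtain n where n: "n \<in> W \<inter> sphere 0 1"
    and max: "\<forall>m \<in> W \<inter> sphere 0 1. axis_info a b r0 r1 m \<le> axis_info a b r0 r1 n"
    using continuous_attains_sup[of "W \<inter> sphere 0 1" "axis_info a b r0 r1"] d(1) by blast
  have "axis_info a b r0 r1 ?d \<noteq> 0" "0 \<le> axis_info a b r0 r1 ?d"
    using axis_info_nonneg[of ?d] d by auto
  then have "axis_info a b r0 r1 n \<noteq> 0" using max d(1) by force
  then have "(r0 - r1) \<bullet> n \<noteq> 0" using axis_info_nonneg(2)[of n] n by auto
  then show thesis using that stationary_critical[OF n extremum_stationary[OF n]] n max by blast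
qed

lemma null_axis:
  obtains n where "n \<in> W \<inter> sphere 0 1"
    "\<And>m. m \<in> W \<inter> sphere 0 1 \<Longrightarrow> (r0 - r1) \<bullet> m = 0 \<longleftrightarrow> axis_of m = axis_of n"
proof -
  let ?d = "(1 / norm (r0 - r1)) *\<^sub>R (r0 - r1)"
  have d: "?d \<in> W" "norm ?d = 1" using distinct W(1) r0W r1W by (auto intro: subspace_scale subspace_diff)
  have zero_iff: "(r0 - r1) \<bullet> m = 0 \<longleftrightarrow> m \<bullet> ?d = 0" for m
    using distinct by (simp add: inner_commute)
  obtain n where n: "n \<in> W" "norm n = 1" "n \<bullet> ?d = 0"
    using plane_orthogonal_unit[OF W d] .
  show thesis
  proof (rule that[of n])
    fix m assume m: "m \<in> W \<inter> sphere 0 1"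
    show "(r0 - r1) \<bullet> m = 0 \<longleftrightarrow> axis_of m = axis_of n"
    proof
      assume "(r0 - r1) \<bullet> m = 0"
      then have eq: "m = (m \<bullet> n) *\<^sub>R n"
        using plane_decomp[OF W d n, of m] m zero_iff[of m] by auto
      then have "\<bar>m \<bullet> n\<bar> = 1" using m n(2) by (metis IntD2 mem_sphere_0 mult.right_neutral norm_scaleR)
      then have "m \<bullet> n = 1 \<or> m \<bullet> n = - 1" by linarith
      then show "axis_of m = axis_of n" unfolding axis_of_eq_iff using eq by auto
    next
      assume "axis_of m = axis_of n"
      then show "(r0 - r1) \<bullet> m = 0" unfolding axis_of_eq_iff zero_iff using n(3) by auto
    qed
  qed (use n in auto)
qed

end

lemma axis_info_same:
  assumes "a + b = 1"
  shows "axis_info a b r r n = 0"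
proof -
  have "a * axis_prob r n + b * axis_prob r n = axis_prob r n" "a * h + b * h = h" for h
    using assms by (metis distrib_right mult_1)+
  then show ?thesis by (simp add: axis_info_def diff_diff_eq)
qed

theorem theorem9p6:
  fixes a b :: real and r0 r1 :: "real^3" and \<rho>0 \<rho>1 :: qmat and W :: "(real^3) set"
  assumes "a > 0" "b > 0" "a + b = 1"
    and "norm r0 \<le> 1" "norm r1 \<le> 1"
    and "\<rho>0 = bloch_state r0" "\<rho>1 = bloch_state r1"
    and "subspace W" "dim W = 2" "span {r0, r1} \<subseteq> W"
  shows
    "(\<rho>0 \<noteq> \<rho>1 \<longrightarrow>
       (\<exists>!R. is_arg_max (posterior_fun a b \<rho>0 \<rho>1) effect R) \<and>
       (\<exists>n1 \<in> W \<inter> sphere 0 1. \<exists>n2 \<in> W \<inter> sphere 0 1.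
          axis_of n1 \<noteq> axis_of n2 \<and>
          {axis_of n | n. n \<in> W \<inter> sphere 0 1 \<and> stationary a b r0 r1 W n} =
            {axis_of n1, axis_of n2} \<and>
          (\<forall>n \<in> W \<inter> sphere 0 1. (r0 - r1) \<bullet> n = 0 \<longleftrightarrow> axis_of n = axis_of n1) \<and>
          axis_info a b r0 r1 n1 = 0 \<and>
          (\<forall>n \<in> W \<inter> sphere 0 1.
             axis_of n \<noteq> axis_of n1 \<longrightarrow> axis_info a b r0 r1 n1 < axis_info a b r0 r1 n) \<and>
          pvm n2 = spectral_projections (R_star a b \<rho>0 \<rho>1) \<and>
          ereal (axis_info a b r0 r1 n2) = acc_info a b \<rho>0 \<rho>1 \<and>
          (\<forall>n \<in> W \<inter> sphere 0 1.
             axis_of n \<noteq> axis_of n2 \<longrightarrow> axis_info a b r0 r1 n < axis_info a b r0 r1 n2))) \<and>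
     (\<rho>0 = \<rho>1 \<longrightarrow>
       (\<forall>n. norm n = 1 \<longrightarrow> axis_info a b r0 r1 n = 0) \<and>
       (\<forall>n \<in> W \<inter> sphere 0 1. stationary a b r0 r1 W n))"
proof (intro conjI impI allI ballI)
  assume "\<rho>0 \<noteq> \<rho>1"
  then have ne: "r0 \<noteq> r1" using assms by auto
  interpret qubit_ensemble_plane a b r0 r1 W
    using assms ne by unfold_locales (auto intro: span_base)
  obtain n1 where n1: "n1 \<in> W \<inter> sphere 0 1"
    and null: "\<And>m. m \<in> W \<inter> sphere 0 1 \<Longrightarrow> (r0 - r1) \<bullet> m = 0 \<longleftrightarrow> axis_of m = axis_of n1"
    using null_axis by blast
  obtain n2 where n2: "n2 \<in> W \<inter> sphere 0 1" and crit: "critical n2" using max_axis by blast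
  have norm2: "norm n2 = 1" and "(r0 - r1) \<bullet> n2 \<noteq> 0" using crit by (auto simp: critical_def)
  have distinct_axes: "axis_of n1 \<noteq> axis_of n2" using null[OF n2] \<open>(r0 - r1) \<bullet> n2 \<noteq> 0\<close> by metis
  have info_zero: "axis_info a b r0 r1 m = 0 \<longleftrightarrow> axis_of m = axis_of n1" if "m \<in> W \<inter> sphere 0 1" for m
    using axis_info_nonneg(2)[of m] null[OF that] that by auto
  have info1: "axis_info a b r0 r1 n1 = 0" using info_zero[OF n1] by simp
  have strict_min: "axis_info a b r0 r1 n1 < axis_info a b r0 r1 m"
    if "m \<in> W \<inter> sphere 0 1" "axis_of m \<noteq> axis_of n1" for m
    using info_zero[OF that(1)] axis_info_nonneg(1)[of m] that info1 by auto
  have strict_max: "axis_info a b r0 r1 m < axis_info a b r0 r1 n2"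
    if "m \<in> W \<inter> sphere 0 1" "axis_of m \<noteq> axis_of n2" for m
    using critical_info_max[OF crit, of m] that by (force simp: axis_of_eq_iff)
  have stationary1: "stationary a b r0 r1 W n1"
    using info1 axis_info_nonneg(1) by (intro extremum_stationary n1) auto
  have stationary2: "stationary a b r0 r1 W n2"
    using critical_info_max(1)[OF crit] by (intro extremum_stationary n2) auto
  \<comment> \<open>Each of two critical axes dominates the other, so their information agrees, and
    strictness of the maximum identifies them.\<close>
  have only: "axis_of m = axis_of n1 \<or> axis_of m = axis_of n2"
    if m: "m \<in> W \<inter> sphere 0 1" "stationary a b r0 r1 W m" for m
  proof (cases "(r0 - r1) \<bullet> m = 0")
    case False
    then have "critical m" using stationary_critical m by blast
    then have "axis_info a b r0 r1 m = axis_info a b r0 r1 n2"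
      using critical_info_max(1)[OF _ norm2] critical_info_max(1)[OF crit, of m] m by force
    then show ?thesis using strict_max[OF m(1)] by fastforce
  qed (use null m in auto)
  have "{axis_of n | n. n \<in> W \<inter> sphere 0 1 \<and> stationary a b r0 r1 W n} = {axis_of n1, axis_of n2}"
    using only n1 n2 stationary1 stationary2 by blast
  moreover have "pvm n2 = spectral_projections (R_star a b \<rho>0 \<rho>1)"
    using posterior_eq_iff[OF norm2] \<open>(r0 - r1) \<bullet> n2 \<noteq> 0\<close>
    by (simp add: assms(6,7) critical_R_star[OF crit] spectral_projections_spec norm2)
  moreover have "ereal (axis_info a b r0 r1 n2) = acc_info a b \<rho>0 \<rho>1"
    unfolding assms(6,7) by (rule critical_acc_info[OF crit, symmetric])
  ultimately show "\<exists>n1 \<in> W \<inter> sphere 0 1. \<exists>n2 \<in> W \<inter> sphere 0 1.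
          axis_of n1 \<noteq> axis_of n2 \<and>
          {axis_of n | n. n \<in> W \<inter> sphere 0 1 \<and> stationary a b r0 r1 W n} =
            {axis_of n1, axis_of n2} \<and>
          (\<forall>n \<in> W \<inter> sphere 0 1. (r0 - r1) \<bullet> n = 0 \<longleftrightarrow> axis_of n = axis_of n1) \<and>
          axis_info a b r0 r1 n1 = 0 \<and>
          (\<forall>n \<in> W \<inter> sphere 0 1.
             axis_of n \<noteq> axis_of n1 \<longrightarrow> axis_info a b r0 r1 n1 < axis_info a b r0 r1 n) \<and>
          pvm n2 = spectral_projections (R_star a b \<rho>0 \<rho>1) \<and>
          ereal (axis_info a b r0 r1 n2) = acc_info a b \<rho>0 \<rho>1 \<and>
          (\<forall>n \<in> W \<inter> sphere 0 1.
             axis_of n \<noteq> axis_of n2 \<longrightarrow> axis_info a b r0 r1 n < axis_info a b r0 r1 n2)"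
    using n1 n2 distinct_axes null info1 strict_min strict_max
    by (intro bexI[of _ n1] bexI[of _ n2] conjI) auto
  show "\<exists>!R. is_arg_max (posterior_fun a b \<rho>0 \<rho>1) effect R"
    unfolding assms(6,7) critical_unique_arg_max[OF crit] by simp
next
  assume "\<rho>0 = \<rho>1"
  then have "r0 = r1" using assms by simp
  then show "axis_info a b r0 r1 n = 0" if "norm n = 1" for n
    using axis_info_same[OF assms(3)] by simp
  \<comment> \<open>Although the information is constant, \<open>stationary\<close> asks for a unit
    tangent in \<open>W\<close>, which has to be exhibited.\<close>
  fix n assume "n \<in> W \<inter> sphere 0 1"
  then obtain t where "t \<in> W" "norm t = 1" "t \<bullet> n = 0"
    using plane_orthogonal_unit[OF assms(8,9), of n] by auto
  then show "stationary a b r0 r1 W n"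
    unfolding stationary_def \<open>r0 = r1\<close> axis_info_same[OF assms(3)] by auto
qed

end
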